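(* Let $\tau$ be an infinite cardinal and $S$ a $\tau$-wide subset of an abelian group $G$ such that $|G|\le 2^{2^\tau}$. Then there exists a precompact Hausdorff group topology $\mathscr{T}$ on $G$ such that $S$ is dense in $(G,\mathscr{T})$.
   Context: $\mathbb{N}$ is the set of positive integers. For a subset $X$ of an abelian group, $nX=\{nx:x\in X\}$ and $\langle X\rangle$ is the subgroup generated by $X$. For an infinite cardinal $\tau$, a subset $S$ of an abelian group $G$ is $\tau$-wide if $nS\setminus\langle S'\rangle\neq\emptyset$ for every $n\in\mathbb{N}$ and each $S'\subseteq S$ with $|S'|<\tau$. A topological group is precompact if it is isomorphic (as a topological group) to a subgroup of some compact Hausdorff group; a group topology is precompact if it makes the group a precompact topological group. *)

theory Defs
  imports "HOL-Analysis.Analysis" "HOL-Algebra.Generated_Groups"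
begin

unbundle cardinal_syntax

(* Congruence's closure operator has the same concrete syntax as the topological one. *)
no_notation eq_closure_of ("closure'_of\<index>")

definition wide :: "'t rel \<Rightarrow> ('a, 'b) monoid_scheme \<Rightarrow> 'a set \<Rightarrow> bool" where
  "wide \<tau> G S \<longleftrightarrow>
     S \<subseteq> carrier G \<and>
     (\<forall>n::nat. \<forall>S'. n > 0 \<and> S' \<subseteq> S \<and> |S'| <o \<tau> \<longrightarrow>
        (\<lambda>x. x [^]\<^bsub>G\<^esub> n) ` S - generate G S' \<noteq> {})"

definition topological_group :: "('a, 'b) monoid_scheme \<Rightarrow> 'a topology \<Rightarrow> bool" where
  "topological_group G T \<longleftrightarrow>
     group G \<and> topspace T = carrier G \<and>
     continuous_map (prod_topology T T) T (\<lambda>(x, y). x \<otimes>\<^bsub>G\<^esub> y) \<and>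
     continuous_map T T (\<lambda>x. inv\<^bsub>G\<^esub> x)"

definition topological_group_iso ::
  "('a, 'b) monoid_scheme \<Rightarrow> 'a topology \<Rightarrow> ('c, 'd) monoid_scheme \<Rightarrow> 'c topology \<Rightarrow> ('a \<Rightarrow> 'c) \<Rightarrow> bool" where
  "topological_group_iso G T H U h \<longleftrightarrow> h \<in> iso G H \<and> homeomorphic_map T U h"

text \<open>Since one cannot quantify over all types, the compact group \<open>K\<close> is taken on a subset of
  the type \<open>'a set set\<close>. This loses nothing: one may replace \<open>K\<close> by the closure of the
  image of \<open>G\<close>, which embeds into \<open>'a set set\<close>; see \<open>precompact_groupI\<close> below, in
  which \<open>K\<close> lives on an arbitrary type.\<close>

definition precompact_group :: "('a, 'b) monoid_scheme \<Rightarrow> 'a topology \<Rightarrow> bool" where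
  "precompact_group G T \<longleftrightarrow>
     topological_group G T \<and>
     (\<exists>(K :: 'a set set monoid) U H h.
        topological_group K U \<and> compact_space U \<and> Hausdorff_space U \<and>
        subgroup H K \<and>
        topological_group_iso G T (K\<lparr>carrier := H\<rparr>) (subtopology U H) h)"

lemma subgroup_closure_of:
  assumes "topological_group K U" "subgroup H K"
  shows "subgroup (U closure_of H) K"
proof -
  interpret group K using assms(1) by (simp add: topological_group_def)
  have top: "topspace U = carrier K" 
    and cm: "continuous_map (prod_topology U U) U (\<lambda>(x, y). x \<otimes>\<^bsub>K\<^esub> y)"
    and ci: "continuous_map U U (\<lambda>x. inv\<^bsub>K\<^esub> x)"
    using assms(1) by (auto simp: topological_group_def)
  have HK: "H \<subseteq> carrier K" by (simp add: assms(2) subgroup.subset)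
  have sub: "H \<subseteq> U closure_of H" by (simp add: HK top closure_of_subset)
  show ?thesis
  proof (rule subgroupI)
    show "U closure_of H \<subseteq> carrier K" using closure_of_subset_topspace[of U H] top by simp
    show "U closure_of H \<noteq> {}" using sub subgroup.one_closed[OF assms(2)] by auto
  next
    fix a assume "a \<in> U closure_of H"
    moreover have "(\<lambda>x. inv\<^bsub>K\<^esub> x) ` (U closure_of H) \<subseteq> U closure_of ((\<lambda>x. inv\<^bsub>K\<^esub> x) ` H)"
      using ci by (rule continuous_map_image_closure_subset)
    moreover have "(\<lambda>x. inv\<^bsub>K\<^esub> x) ` H \<subseteq> H" using subgroup.m_inv_closed[OF assms(2)] by auto
    ultimately show "inv\<^bsub>K\<^esub> a \<in> U closure_of H" using closure_of_mono by blast
  next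
    fix a b assume "a \<in> U closure_of H" "b \<in> U closure_of H"
    then have "(a, b) \<in> prod_topology U U closure_of (H \<times> H)" by (simp add: closure_of_Times)
    moreover have "(\<lambda>(x, y). x \<otimes>\<^bsub>K\<^esub> y) ` (prod_topology U U closure_of (H \<times> H))
        \<subseteq> U closure_of ((\<lambda>(x, y). x \<otimes>\<^bsub>K\<^esub> y) ` (H \<times> H))"
      using cm by (rule continuous_map_image_closure_subset)
    moreover have "(\<lambda>(x, y). x \<otimes>\<^bsub>K\<^esub> y) ` (H \<times> H) \<subseteq> H"
      using subgroup.m_closed[OF assms(2)] by auto
    ultimately show "a \<otimes>\<^bsub>K\<^esub> b \<in> U closure_of H" using closure_of_mono by blast
  qed
qed

lemma topological_group_subgroup:
  assumes "topological_group K U" "subgroup C K"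
  shows "topological_group (K\<lparr>carrier := C\<rparr>) (subtopology U C)"
proof -
  interpret group K using assms(1) by (simp add: topological_group_def)
  have top: "topspace U = carrier K" 
    and cm: "continuous_map (prod_topology U U) U (\<lambda>(x, y). x \<otimes>\<^bsub>K\<^esub> y)"
    and ci: "continuous_map U U (\<lambda>x. inv\<^bsub>K\<^esub> x)"
    using assms(1) by (auto simp: topological_group_def)
  have CK: "C \<subseteq> carrier K" by (simp add: assms(2) subgroup.subset)
  have gr: "group (K\<lparr>carrier := C\<rparr>)" using assms(2) by (simp add: subgroup_imp_group)
  have tC: "topspace (subtopology U C) = C" using CK top by auto
  have 1: "continuous_map (prod_topology (subtopology U C) (subtopology U C)) (subtopology U C)
      (\<lambda>(x, y). x \<otimes>\<^bsub>K\<^esub> y)"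
    unfolding continuous_map_in_subtopology
    using continuous_map_from_subtopology[OF cm, of "C \<times> C"] subgroup.m_closed[OF assms(2)]
    by (auto simp: subtopology_Times tC)
  have "continuous_map (subtopology U C) (subtopology U C) (\<lambda>x. inv\<^bsub>K\<^esub> x)"
    unfolding continuous_map_in_subtopology
    using continuous_map_from_subtopology[OF ci, of C] subgroup.m_inv_closed[OF assms(2)] tC
    by auto
  then have 2: "continuous_map (subtopology U C) (subtopology U C) (\<lambda>x. inv\<^bsub>K\<lparr>carrier := C\<rparr>\<^esub> x)"
    by (rule continuous_map_eq) (use tC m_inv_consistent[OF assms(2)] in auto)
  show ?thesis using gr 1 2 tC by (simp add: topological_group_def)
qed

lemma topological_group_transport:
  fixes K :: "('k, 'b) monoid_scheme" and \<phi> :: "'k \<Rightarrow> 'c"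
  assumes K: "topological_group K U" and inj: "inj_on \<phi> (carrier K)"
  obtains L :: "'c monoid" and V
  where "topological_group L V" "\<phi> \<in> iso K L" "homeomorphic_map U V \<phi>"
proof -
  interpret group K using K by (simp add: topological_group_def)
  have top: "topspace U = carrier K" 
    and cm: "continuous_map (prod_topology U U) U (\<lambda>(x, y). x \<otimes>\<^bsub>K\<^esub> y)"
    and ci: "continuous_map U U (\<lambda>x. inv\<^bsub>K\<^esub> x)"
    using K by (auto simp: topological_group_def)
  define \<psi> where "\<psi> = inv_into (carrier K) \<phi>"
  have \<psi>\<phi>: "\<psi> (\<phi> x) = x" if "x \<in> carrier K" for x
    using inj that by (simp add: \<psi>_def)
  define L :: "'c monoid" where
    "L = \<lparr>carrier = \<phi> ` carrier K, mult = (\<lambda>a b. \<phi> (\<psi> a \<otimes>\<^bsub>K\<^esub> \<psi> b)), one = \<phi> \<one>\<^bsub>K\<^esub>\<rparr>"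
  define V where "V = pullback_topology (\<phi> ` carrier K) \<psi> U"
  have iso: "\<phi> \<in> iso K L"
    using inj by (auto simp: iso_def hom_def bij_betw_def L_def \<psi>\<phi>)
  have "group (L\<lparr>one := \<phi> \<one>\<^bsub>K\<^esub>\<rparr>)" using iso by (rule iso_imp_img_group)
  then have L: "group L" by (simp add: L_def)
  have tV: "topspace V = \<phi> ` carrier K"
    using \<psi>\<phi> by (auto simp: V_def topspace_pullback_topology top)
  have c\<phi>: "continuous_map U V \<phi>" unfolding V_def
  proof (rule continuous_map_pullback')
    show "continuous_map U U (\<psi> \<circ> \<phi>)"
      by (rule continuous_map_eq[OF continuous_map_id]) (simp add: \<psi>\<phi> top)
  qed (auto simp: top)
  have c\<psi>: "continuous_map V U \<psi>"
    using continuous_map_pullback[OF continuous_map_id, of "\<phi> ` carrier K" \<psi> U]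
    by (simp add: V_def)
  have hom: "homeomorphic_map U V \<phi>"
    unfolding homeomorphic_map_maps homeomorphic_maps_def
    using c\<phi> c\<psi> \<psi>\<phi> by (auto simp: top tV)
  have "continuous_map (prod_topology V V) V
      (\<phi> \<circ> (\<lambda>(x, y). x \<otimes>\<^bsub>K\<^esub> y) \<circ> (\<lambda>(x, y). (\<psi> x, \<psi> y)))"
    by (intro continuous_map_compose[OF _ continuous_map_compose[OF cm c\<phi>]])
       (simp add: continuous_map_prod_top c\<psi>)
  then have m: "continuous_map (prod_topology V V) V (\<lambda>(x, y). x \<otimes>\<^bsub>L\<^esub> y)"
    by (simp add: L_def o_def case_prod_unfold)
  have invL: "inv\<^bsub>L\<^esub> x = \<phi> (inv\<^bsub>K\<^esub> (\<psi> x))" if "x \<in> carrier L" for x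
  proof -
    obtain k where k: "k \<in> carrier K" "x = \<phi> k" using \<open>x \<in> carrier L\<close> by (auto simp: L_def)
    interpret gh: group_hom K L \<phi>
      using iso L by (simp add: group_hom_def group_hom_axioms_def iso_def is_group)
    show ?thesis using k by (simp add: \<psi>\<phi>)
  qed
  have "continuous_map V V (\<phi> \<circ> (\<lambda>x. inv\<^bsub>K\<^esub> x) \<circ> \<psi>)"
    by (intro continuous_map_compose[OF c\<psi> continuous_map_compose[OF ci c\<phi>]])
  then have i: "continuous_map V V (\<lambda>x. inv\<^bsub>L\<^esub> x)"
    by (rule continuous_map_eq) (use invL in \<open>simp add: tV L_def\<close>)
  have "topological_group L V"
    unfolding topological_group_def using L m i tV by (simp add: L_def)
  then show thesis using iso hom that by blast
qed

lemma precompact_groupI: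
  fixes G :: "('a, 'b) monoid_scheme" and K :: "('k, 'd) monoid_scheme"
  assumes G: "topological_group G T" and K: "topological_group K U"
    and cpt: "compact_space U" and hd: "Hausdorff_space U" and H: "subgroup H K"
    and h: "topological_group_iso G T (K\<lparr>carrier := H\<rparr>) (subtopology U H) h"
  shows "precompact_group G T"
proof -
  interpret K: group K using K by (simp add: topological_group_def)
  define C where "C = U closure_of H"
  define K1 where "K1 = K\<lparr>carrier := C\<rparr>"
  define U1 where "U1 = subtopology U C"
  have top: "topspace U = carrier K" using K by (simp add: topological_group_def)
  have HK: "H \<subseteq> carrier K" using H by (simp add: subgroup.subset)
  have HC: "H \<subseteq> C" by (simp add: C_def HK top closure_of_subset)
  have Csub: "subgroup C K" using subgroup_closure_of[OF K H] by (simp add: C_def)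
  have K1: "topological_group K1 U1"
    using topological_group_subgroup[OF K Csub] by (simp add: K1_def U1_def)
  have top1: "topspace U1 = C" using K1 by (simp add: topological_group_def K1_def)
  have cpt1: "compact_space U1"
    by (simp add: U1_def C_def closedin_compact_space compact_space_subtopology cpt)
  have hd1: "Hausdorff_space U1" by (simp add: U1_def Hausdorff_space_subtopology hd)
  have H1: "subgroup H K1"
    using K.subgroup_incl[OF H Csub HC] by (simp add: K1_def)
  have him: "h ` carrier G = H"
    using h by (simp add: topological_group_iso_def iso_def bij_betw_def)
  define \<phi> :: "'k \<Rightarrow> 'a set set" where
    "\<phi> x = {{g \<in> carrier G. h g \<in> W} | W. openin U W \<and> x \<in> W}" for x
  have "inj_on \<phi> C"
  proof (rule inj_onI, rule ccontr)
    fix x y assume xy: "x \<in> C" "y \<in> C" "\<phi> x = \<phi> y" "x \<noteq> y"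
    then have xyU: "x \<in> topspace U \<and> y \<in> topspace U \<and> x \<noteq> y"
      using closure_of_subset_topspace[of U H] by (auto simp: C_def)
    have "\<exists>A B. openin U A \<and> openin U B \<and> x \<in> A \<and> y \<in> B \<and> disjnt A B"
      using hd[unfolded Hausdorff_space_def] xyU by simp
    then obtain A B where AB: "openin U A" "openin U B" "x \<in> A" "y \<in> B" "disjnt A B"
      by metis
    have "{g \<in> carrier G. h g \<in> A} \<in> \<phi> x"
      unfolding \<phi>_def using AB(1,3) by blast
    then have "{g \<in> carrier G. h g \<in> A} \<in> \<phi> y" by (simp only: xy(3))
    then obtain W where W: "openin U W" "y \<in> W" "{g \<in> carrier G. h g \<in> A} = {g \<in> carrier G. h g \<in> W}"
      unfolding \<phi>_def by auto
    have "openin U (W \<inter> B)" "y \<in> W \<inter> B" using W AB by auto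
    then obtain z where "z \<in> H" "z \<in> W \<inter> B"
      using xy(2) unfolding C_def in_closure_of by blast
    then obtain g where "g \<in> carrier G" "h g \<in> W" "h g \<in> B" using him by blast
    then have "h g \<in> A" using W(3) by blast
    then show False using AB(5) \<open>h g \<in> B\<close> by (auto simp: disjnt_iff)
  qed
  then have inj1: "inj_on \<phi> (carrier K1)" by (simp add: K1_def)
  then obtain L :: "'a set set monoid" and V
    where L: "topological_group L V" "\<phi> \<in> iso K1 L" "homeomorphic_map U1 V \<phi>"
    using topological_group_transport[OF K1 inj1] by blast
  have cV: "compact_space V" and hV: "Hausdorff_space V"
    using L(3) cpt1 hd1 homeomorphic_compact_space homeomorphic_Hausdorff_space
      homeomorphic_map_imp_homeomorphic_space by blast+
  have gK1: "group K1" and gL: "group L" using K1 L(1) by (auto simp: topological_group_def)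
  interpret gh: group_hom K1 L \<phi>
    using L(2) gK1 gL by (simp add: group_hom_def group_hom_axioms_def iso_def)
  have sL: "subgroup (\<phi> ` H) L" using H1 by (rule gh.subgroup_img_is_subgroup)
  have "\<phi> \<in> iso (K\<lparr>carrier := H\<rparr>) (L\<lparr>carrier := \<phi> ` H\<rparr>)"
  proof -
    have "inj_on \<phi> H"
      using inj1 HC by (auto simp: K1_def intro: inj_on_subset)
    moreover have "\<phi> (x \<otimes>\<^bsub>K\<^esub> y) = \<phi> x \<otimes>\<^bsub>L\<^esub> \<phi> y" if "x \<in> H" "y \<in> H" for x y
      using gh.hom_mult[of x y] HC that by (simp add: K1_def subset_iff)
    ultimately show ?thesis by (simp add: iso_def hom_def bij_betw_def)
  qed
  then have i: "\<phi> \<circ> h \<in> iso G (L\<lparr>carrier := \<phi> ` H\<rparr>)"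
    using h by (auto simp: topological_group_iso_def intro: iso_set_trans)
  have "homeomorphic_map (subtopology U1 H) (subtopology V (\<phi> ` H)) \<phi>"
    using L(3)
  proof (rule homeomorphic_map_subtopologies)
    show "\<phi> ` (topspace U1 \<inter> H) = topspace V \<inter> \<phi> ` H"
      using HC top1 homeomorphic_imp_surjective_map[OF L(3)] by blast
  qed
  moreover have "subtopology U1 H = subtopology U H"
    using HC by (simp add: U1_def subtopology_subtopology Int_absorb1)
  ultimately have "homeomorphic_map T (subtopology V (\<phi> ` H)) (\<phi> \<circ> h)"
    using h homeomorphic_map_compose by (fastforce simp: topological_group_iso_def)
  then show ?thesis
    unfolding precompact_group_def topological_group_iso_def
    using G L(1) cV hV sL i by blast
qed

end

(*
  Let W be the underlying set of \<tau>.  By wideness one picks elements s_a of S (a in W) by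
  transfinite recursion so that the order of s_a modulo the subgroup generated by its predecessors
  is infinite or larger than a prescribed number m_a.  Hence a character can be built step by step
  along the s_a, and then along all remaining elements of G, such that its value at s_a lies within
  O(1/m_a) of an arbitrary prescribed point of the circle.

  Take one character for each sequence i of subsets of W.  As in the Hewitt-Marczewski-Pondiczery
  theorem, prescribing at s_a a value that depends only on finitely many bits of i makes the image
  of S dense in every finite product of these characters.  The freedom that remains at every step
  (multiplication by a small element of the right order) is used to separate points: it is switched
  on or off according to the tail of i, by means of 2^(2^\<tau>) tail conditions that are independent
  of each other and of the finite bits.  The character at g depends on finitely many bits and
  switches only, so flipping the switch of the last generator occurring in g changes its value.
*)
theory Submission
  imports Defs "HOL-Algebra.Free_Abelian_Groups"
begin

section \<open>The circle group and generated subgroups\<close>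

definition circle :: "complex monoid" where
  "circle = \<lparr>carrier = sphere 0 1, monoid.mult = (*), one = 1\<rparr>"

lemma circle_simps [simp]:
  "carrier circle = sphere 0 1" "x \<otimes>\<^bsub>circle\<^esub> y = x * y" "\<one>\<^bsub>circle\<^esub> = 1"
  by (simp_all add: circle_def)

lemma comm_group_circle: "comm_group circle"
proof (rule comm_groupI)
  fix x assume "x \<in> carrier circle"
  then have "inverse x \<in> carrier circle" "inverse x * x = 1"
    by (auto simp: norm_inverse intro!: left_inverse)
  then show "\<exists>y\<in>carrier circle. y \<otimes>\<^bsub>circle\<^esub> x = \<one>\<^bsub>circle\<^esub>" by auto
qed (auto simp: norm_mult)

interpretation circle: comm_group circle by (rule comm_group_circle)

lemma inv_circle [simp]: "norm x = 1 \<Longrightarrow> inv\<^bsub>circle\<^esub> x = inverse x"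
  by (rule circle.inv_equality) (auto simp: norm_inverse intro!: left_inverse)

lemma nat_pow_circle [simp]: "x [^]\<^bsub>circle\<^esub> (n::nat) = x ^ n"
  by (induction n) (auto simp: mult.commute)

lemma int_pow_circle [simp]: "norm x = 1 \<Longrightarrow> x [^]\<^bsub>circle\<^esub> (k::int) = x powi k"
  by (simp add: int_pow_def2 power_int_def norm_power power_inverse)

lemma (in comm_group) generate_insert:
  assumes "a \<in> carrier G" "B \<subseteq> carrier G" "x \<in> generate G (insert a B)"
  obtains h k where "h \<in> generate G B" "x = h \<otimes> a [^] (k::int)"
proof -
  have sub: "generate G B \<subseteq> carrier G" using assms(2) by (rule generate_incl)
  have "\<exists>h k. h \<in> generate G B \<and> x = h \<otimes> a [^] (k::int)" using assms(3)
  proof induction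
    case one
    have "\<one> = \<one> \<otimes> a [^] (0::int)" by simp
    then show ?case using generate.one by blast
  next
    case (incl x)
    then show ?case
    proof
      assume "x = a"
      then have "x = \<one> \<otimes> a [^] (1::int)" using assms(1) by simp
      then show ?thesis using generate.one by blast
    next
      assume "x \<in> B"
      then have "x = x \<otimes> a [^] (0::int)" using assms(2) by auto
      then show ?thesis using generate.incl \<open>x \<in> B\<close> by metis
    qed
  next
    case (inv x)
    then show ?case
    proof
      assume "x = a"
      then have "inv x = \<one> \<otimes> a [^] (-1::int)" using assms(1) by (simp add: int_pow_neg)
      then show ?thesis using generate.one by blast
    next
      assume "x \<in> B"
      then have "inv x = inv x \<otimes> a [^] (0::int)" using assms(2) by auto
      then show ?thesis using generate.inv \<open>x \<in> B\<close> by metis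
    qed
  next
    case (eng x y)
    then obtain h k h' k' where *: "h \<in> generate G B" "x = h \<otimes> a [^] (k::int)"
      "h' \<in> generate G B" "y = h' \<otimes> a [^] (k'::int)" by blast
    then have "x \<otimes> y = (h \<otimes> h') \<otimes> a [^] (k + k')"
      using sub assms(1) by (simp add: int_pow_mult subset_iff m_ac)
    then show ?case using * generate.eng by metis
  qed
  then show thesis using that by blast
qed

text \<open>Only finitely many generators enter an element, and in a total order one of them is the
  last. In the induction the larger of the bounds of two factors serves for their product. The unit
  is listed separately because it may come from no generator at all.\<close>

lemma (in group) generate_total_cases:
  assumes "trans R" "total_on D R" "x \<in> generate G (f ` D)"
    "f ` D \<subseteq> carrier G"
  shows "x = \<one> \<or> (\<exists>w\<in>D. x \<in> generate G (f ` {v\<in>D. v = w \<or> (v, w) \<in> R}))"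
  using assms(3)
proof induction
  case (incl h)
  then show ?case by (auto intro: generate.incl)
next
  case (inv h)
  then show ?case by (auto intro: generate.inv)
next
  case (eng x y)
  let ?L = "\<lambda>w. {v\<in>D. v = w \<or> (v, w) \<in> R}"
  show ?case
  proof (cases "x = \<one> \<or> y = \<one>")
    case True
    moreover have "x \<in> carrier G" "y \<in> carrier G"
      using eng.hyps assms(4) generate_in_carrier by blast+
    ultimately show ?thesis using eng.IH by auto
  next
    case False
    then obtain v w where vw: "v \<in> D" "x \<in> generate G (f ` ?L v)" "w \<in> D" "y \<in> generate G (f ` ?L w)"
      using eng.IH by blast
    have mono: "generate G (f ` ?L a) \<subseteq> generate G (f ` ?L b)" if "a = b \<or> (a, b) \<in> R" for a b
      using that assms(1) by (intro mono_generate image_mono) (auto dest: transD)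
    have "v = w \<or> (v, w) \<in> R \<or> (w, v) \<in> R" using assms(2) vw by (auto simp: total_on_def)
    then obtain u where u: "u \<in> D" "x \<in> generate G (f ` ?L u)" "y \<in> generate G (f ` ?L u)"
      using vw mono[of v w] mono[of w v] by blast
    then have "x \<otimes> y \<in> generate G (f ` ?L u)" by (intro generate.eng)
    with u(1) show ?thesis by (intro disjI2 bexI)
  qed
qed simp

text \<open>The exponents of the powers of \<open>g\<close> in \<open>H\<close> form a subgroup of
  the integers, which is cyclic. Its generator \<open>d\<close> is the least positive exponent, or
  \<open>0\<close> if there is none, since \<open>int 0 dvd k\<close> means
  \<open>k = 0\<close>.\<close>

lemma (in group) subgroup_int_pow_mem_iff:
  assumes H: "subgroup H G" and g: "g \<in> carrier G"
  shows "\<exists>d::nat. \<forall>k::int. g [^] k \<in> H \<longleftrightarrow> int d dvd k"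
proof (cases "\<exists>n::nat. n > 0 \<and> g [^] int n \<in> H")
  case True
  define d where "d = (LEAST n::nat. n > 0 \<and> g [^] int n \<in> H)"
  have d: "d > 0" "g [^] int d \<in> H" using LeastI_ex[OF True] by (auto simp: d_def)
  have least: "d \<le> n" if "n > 0" "g [^] int n \<in> H" for n
    unfolding d_def using that by (intro Least_le) auto
  have mult: "g [^] (int d * j) \<in> H" for j
    using subgroup_int_pow_closed[OF H d(2), of j] g by (simp add: int_pow_pow)
  have "int d dvd k" if k: "g [^] k \<in> H" for k
  proof -
    have "g [^] (k mod int d) = g [^] k \<otimes> inv (g [^] (int d * (k div int d)))"
      using g by (simp add: int_pow_diff[symmetric] minus_mult_div_eq_mod)
    then have "g [^] (k mod int d) \<in> H"
      using k mult[of "k div int d"] H by (simp add: subgroup.m_closed subgroup.m_inv_closed)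
    moreover have "k mod int d = int (nat (k mod int d))" "nat (k mod int d) < d"
      using d(1) by (simp_all add: nat_less_iff)
    ultimately have "k mod int d = 0"
      using least[of "nat (k mod int d)"] by (metis gr0I leD of_nat_0)
    then show ?thesis by auto
  qed
  then show ?thesis using mult by (metis dvd_def)
next
  case False
  have "k = 0" if k: "g [^] k \<in> H" for k :: int
  proof (rule ccontr)
    assume "k \<noteq> 0"
    have "g [^] \<bar>k\<bar> \<in> H"
      using k g subgroup.m_inv_closed[OF H k] by (auto simp: abs_if int_pow_neg)
    then have "nat \<bar>k\<bar> > 0 \<and> g [^] int (nat \<bar>k\<bar>) \<in> H" using \<open>k \<noteq> 0\<close> by simp
    then show False using False by blast
  qed
  then have "\<forall>k::int. g [^] k \<in> H \<longleftrightarrow> int 0 dvd k" using H by (auto simp: subgroup.one_closed)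
  then show ?thesis by blast
qed

section \<open>Roots and elements of given order on the circle\<close>

lemma norm_cis_diff_le: "norm (cis a - cis b) \<le> \<bar>a - b\<bar>"
proof -
  have "cis a - cis b = cis b * (cis (a - b) - 1)" by (simp add: algebra_simps cis_mult)
  then have "norm (cis a - cis b) = norm (exp (\<i> * of_real (a - b)) - 1)"
    by (simp only: norm_mult norm_cis cis_conv_exp) (simp add: mult.commute)
  also have "\<dots> = 2 * \<bar>sin ((a - b) / 2)\<bar>" by (rule dist_exp_i_1)
  also have "\<dots> \<le> 2 * \<bar>(a - b) / 2\<bar>" by (intro mult_left_mono abs_sin_x_le_abs_x) auto
  finally show ?thesis by simp
qed

lemma norm_1_eq_cis: "norm (z::complex) = 1 \<Longrightarrow> \<exists>a. z = cis a"
  by (metis complex_unimodular_polar cis.code)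

text \<open>For positive \<open>d\<close> the \<open>d\<close>-th roots of \<open>y\<close> are
  spaced by the angle \<open>2 * pi / d\<close>, so one of them lies within \<open>pi / d\<close>,
  hence within \<open>pi / m\<close>, of \<open>t\<close>. For \<open>d = 0\<close> no root is asked
  for and \<open>t\<close> itself serves.\<close>

lemma exists_near_root:
  fixes y t :: complex
  assumes m: "m > 0" "d = 0 \<or> m \<le> d" and y: "norm y = 1" and t: "norm t = 1"
  shows "\<exists>x. norm x = 1 \<and> (d > 0 \<longrightarrow> x ^ d = y) \<and> norm (x - t) \<le> pi / real m"
proof (cases "d = 0")
  case True
  then show ?thesis using t by (intro exI[of _ t]) auto
next
  case False
  then have d: "m \<le> d" "d > 0" using m by auto
  obtain a b where ab: "y = cis a" "t = cis b" using norm_1_eq_cis y t by metis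
  \<comment> \<open>Among the angles \<open>(a + 2 * pi * j) / d\<close> of the roots, this
    \<open>j\<close> gives one nearest to \<open>b\<close>.\<close>
  define j where "j = round ((d * b - a) / (2 * pi))"
  define c where "c = (a + 2 * pi * j) / d"
  have "\<bar>of_int j - (d * b - a) / (2 * pi)\<bar> \<le> 1 / 2" unfolding j_def by (rule of_int_round_abs_le)
  then have "\<bar>of_int j - (d * b - a) / (2 * pi)\<bar> * (2 * pi) \<le> 1 / 2 * (2 * pi)"
    by (rule mult_right_mono) simp
  then have "\<bar>(of_int j - (d * b - a) / (2 * pi)) * (2 * pi)\<bar> \<le> pi"
    by (simp only: abs_mult) simp
  moreover have "(of_int j - (d * b - a) / (2 * pi)) * (2 * pi) = d * (c - b)"
    using d by (simp add: c_def field_simps)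
  ultimately have "d * \<bar>c - b\<bar> \<le> pi" by (simp add: abs_mult)
  then have "\<bar>c - b\<bar> \<le> pi / d" using d by (simp add: field_simps)
  also have "\<dots> \<le> pi / m" using d m by (intro divide_left_mono) auto
  finally have "norm (cis c - t) \<le> pi / m" using norm_cis_diff_le[of c b] ab by simp
  moreover have "cis c ^ d = y"
  proof -
    have "real d * c = a + 2 * pi * j" using d by (simp add: c_def)
    then have "cis c ^ d = cis (a + 2 * pi * j)" by (simp only: Complex.DeMoivre)
    also have "\<dots> = cis a * cis (2 * pi * j)" by (simp only: cis_mult)
    also have "cis (2 * pi * j) = 1" by (rule cis_multiple_2pi) auto
    finally show ?thesis using ab by simp
  qed
  ultimately show ?thesis by (intro exI[of _ "cis c"]) auto
qed

lemma cis_eq_1_iff: "cis x = 1 \<longleftrightarrow> (\<exists>n::int. x = of_int n * 2 * pi)"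
proof -
  have "cis x = 1 \<longleftrightarrow> cos x = 1"
    using sin_cos_squared_add[of x] by (auto simp: complex_eq_iff power2_eq_square)
  then show ?thesis by (simp add: cos_one_2pi_int)
qed

lemma cis_2pi_powi_eq_1_iff: "cis (2 * pi * r) powi k = 1 \<longleftrightarrow> of_int k * r \<in> \<int>"
proof -
  have "cis (2 * pi * r) powi k = cis (of_int k * (2 * pi * r))"
    by (simp add: cis_power_int)
  also have "\<dots> = 1 \<longleftrightarrow> (\<exists>n::int. of_int k * (2 * pi * r) = of_int n * 2 * pi)"
    using cis_eq_1_iff[of "of_int k * (2 * pi * r)"] by simp
  also have "\<dots> \<longleftrightarrow> (\<exists>n::int. of_int k * r = of_int n)"
    by (intro arg_cong[where f=Ex] ext) (simp add: field_simps)
  also have "\<dots> \<longleftrightarrow> of_int k * r \<in> \<int>" by (auto simp: Ints_def)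
  finally show ?thesis .
qed

text \<open>A rotation by \<open>r\<close> turns has the required order if \<open>r = 1 / d\<close>,
  or if \<open>r\<close> is an irrational number below \<open>1 / m\<close> when
  \<open>d = 0\<close> stands for infinite order. Multiplication by such a \<open>z\<close> moves a
  \<open>d\<close>-th root to another one close by, and this is the freedom used to separate
  points.\<close>

lemma exists_small_of_order:
  assumes m: "m > 0" "d = 0 \<or> m \<le> d"
  shows "\<exists>z::complex. norm z = 1 \<and> z ^ d = 1 \<and> (\<forall>k::int. z powi k = 1 \<longrightarrow> int d dvd k) \<and> norm (z - 1) \<le> 2 * pi / real m"
proof -
  obtain r where r: "0 \<le> r" "r \<le> 1 / m" "of_int (int d) * r \<in> \<int>" "\<And>k::int. of_int k * r \<in> \<int> \<Longrightarrow> int d dvd k"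
  proof (cases "d = 0")
    case True
    have "uncountable {0<..<1 / real m}" using m by (simp add: uncountable_open_interval)
    then have "\<not> {0<..<1 / real m} \<subseteq> \<rat>" using countable_rat countable_subset by blast
    then obtain r where r: "r \<in> {0<..<1 / real m}" "r \<notin> \<rat>" by blast
    have "k = 0" if k: "of_int k * r \<in> \<int>" for k :: int
    proof (rule ccontr)
      assume "k \<noteq> 0"
      then have "r = of_int k * r / of_int k" by simp
      also have "\<dots> \<in> \<rat>" using k Ints_subset_Rats by (intro Rats_divide) auto
      finally show False using r by simp
    qed
    then show thesis using that[of r] r True by auto
  next
    case False
    then have d: "m \<le> d" "d > 0" using m by auto
    have "int d dvd k" if k: "of_int k * (1 / real d) \<in> \<int>" for k :: int
    proof -
      obtain n :: int where "of_int k * (1 / real d) = of_int n" using k unfolding Ints_def by blast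
      then have "real_of_int k = real_of_int (n * int d)" using d by (simp add: field_simps)
      then show ?thesis unfolding of_int_eq_iff by simp
    qed
    then show thesis using that[of "1 / d"] d m by (auto simp: field_simps)
  qed
  have "cis (2 * pi * r) powi int d = 1" using r(3) by (simp only: cis_2pi_powi_eq_1_iff)
  moreover have "norm (cis (2 * pi * r) - 1) \<le> 2 * pi / m"
  proof -
    have "norm (cis (2 * pi * r) - 1) \<le> 2 * pi * r" using norm_cis_diff_le[of "2 * pi * r" 0] r(1) by (simp add: abs_mult)
    also have "\<dots> \<le> 2 * pi * (1 / m)" using r(2) by (intro mult_left_mono) auto
    finally show ?thesis by simp
  qed
  ultimately show ?thesis
    using r(4) by (intro exI[of _ "cis (2 * pi * r)"]) (auto simp: cis_2pi_powi_eq_1_iff)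
qed

text \<open>Rounding the angle to a multiple of \<open>1 / m\<close> suffices. With target values
  restricted to such points, the step functions below are described by integers instead of arbitrary
  points of the circle and stay few enough to be enumerated.\<close>

lemma exists_near_cis:
  assumes "m > 0" "norm z = 1"
  shows "\<exists>p::int. norm (cis (of_int p / real m) - z) \<le> 1 / real m"
proof -
  obtain a where a: "z = cis a" using norm_1_eq_cis assms by blast
  have "\<bar>of_int (round (m * a)) - m * a\<bar> \<le> 1 / 2" by (rule of_int_round_abs_le)
  then have "\<bar>of_int (round (m * a)) - m * a\<bar> / m \<le> 1 / m" using assms by (intro divide_right_mono) auto
  moreover have "\<bar>of_int (round (m * a)) - m * a\<bar> / m = \<bar>(of_int (round (m * a)) - m * a) / m\<bar>" by simp
  moreover have "(of_int (round (m * a)) - m * a) / m = of_int (round (m * a)) / m - a"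
    using assms by (simp add: diff_divide_distrib)
  ultimately have "\<bar>of_int (round (m * a)) / m - a\<bar> \<le> 1 / m" by simp
  then show ?thesis using norm_cis_diff_le[of "of_int (round (m * a)) / m" a] a by (intro exI[of _ "round (m * a)"]) simp
qed

section \<open>Characters defined by transfinite recursion\<close>

text \<open>\<^term>\<open>d w\<close> is the order of \<^term>\<open>s w\<close> modulo the subgroup generated by its predecessors, with
  \<^term>\<open>0\<close> standing for infinite order.\<close>

locale transfinite_generators = comm_group G for G (structure) +
  fixes \<Lambda> :: "'w set" and R :: "'w rel" and s :: "'w \<Rightarrow> 'a" and d :: "'w \<Rightarrow> nat"
  assumes wf: "wf R" and trans: "trans R" and total: "total_on \<Lambda> R"
    and s_closed: "s ` \<Lambda> \<subseteq> carrier G"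
    and s_generate: "generate G (s ` \<Lambda>) = carrier G"
    and pow_mem_iff: "w \<in> \<Lambda> \<Longrightarrow> s w [^] (k::int) \<in> generate G (s ` {v\<in>\<Lambda>. (v, w) \<in> R}) \<longleftrightarrow> int (d w) dvd k"
begin

abbreviation below :: "'w \<Rightarrow> 'w set" where
  "below w \<equiv> {v\<in>\<Lambda>. (v, w) \<in> R}"

abbreviation below_eq :: "'w \<Rightarrow> 'w set" where
  "below_eq w \<equiv> {v\<in>\<Lambda>. v = w \<or> (v, w) \<in> R}"

lemma pow_order_mem: "w \<in> \<Lambda> \<Longrightarrow> s w [^] d w \<in> generate G (s ` below w)"
  using pow_mem_iff[of w "int (d w)"] by (simp add: int_pow_int)

text \<open>A character with \<^term>\<open>x v\<close> as its value at \<^term>\<open>s v\<close> exists iff this subgroup is the graph of a function.\<close>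

definition graph :: "('w \<Rightarrow> complex) \<Rightarrow> 'w set \<Rightarrow> ('a \<times> complex) set" where
  "graph x D = generate (G \<times>\<times> circle) ((\<lambda>v. (s v, x v)) ` D)"

lemma graph_cong: "(\<And>v. v \<in> D \<Longrightarrow> x v = y v) \<Longrightarrow> graph x D = graph y D"
  unfolding graph_def by (intro arg_cong[where f="generate (G \<times>\<times> circle)"] image_cong) auto

lemma comm_group_DirProd_circle: "comm_group (G \<times>\<times> circle)"
proof -
  interpret P: group "G \<times>\<times> circle" by (rule DirProd_group) auto
  show ?thesis by unfold_locales (auto simp: m_comm)
qed

interpretation P: comm_group "G \<times>\<times> circle" by (rule comm_group_DirProd_circle)

lemma int_pow_DirProd_circle:
  assumes "a \<in> carrier G" "norm z = 1"
  shows "(a, z) [^]\<^bsub>G \<times>\<times> circle\<^esub> (k::int) = (a [^] k, z powi k)"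
proof -
  have nat: "(a, z) [^]\<^bsub>G \<times>\<times> circle\<^esub> (n::nat) = (a [^] n, z ^ n)" for n
    by (induction n) (auto simp: mult.commute)
  show ?thesis
  proof (cases k)
    case (nonneg n)
    then show ?thesis by (simp add: int_pow_int nat)
  next
    case (neg n)
    then obtain m :: nat where k: "k = - int m" by blast
    have "(a [^] m, z ^ m) \<in> carrier (G \<times>\<times> circle)" using assms by (simp add: norm_power)
    then have "inv\<^bsub>G \<times>\<times> circle\<^esub> (a [^] m, z ^ m) = (inv (a [^] m), inverse (z ^ m))"
      using assms by (subst inv_DirProd) (auto simp: norm_power)
    then show ?thesis
      using assms by (simp add: k P.int_pow_neg_int int_pow_neg_int nat power_int_minus)
  qed
qed

section \<open>Extending partial characters along the generators\<close>

context
  fixes x :: "'w \<Rightarrow> complex"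
  assumes norm_x: "\<And>v. norm (x v) = 1"
begin

lemma graph_closed: "D \<subseteq> \<Lambda> \<Longrightarrow> (\<lambda>v. (s v, x v)) ` D \<subseteq> carrier (G \<times>\<times> circle)"
  using s_closed norm_x by auto

lemma subgroup_graph: "D \<subseteq> \<Lambda> \<Longrightarrow> subgroup (graph x D) (G \<times>\<times> circle)"
  unfolding graph_def by (intro P.generate_is_subgroup graph_closed)

lemma graph_total:
  assumes D: "D \<subseteq> \<Lambda>" and g: "g \<in> generate G (s ` D)"
  shows "\<exists>y. (g, y) \<in> graph x D"
  using g
proof induction
  case one
  then show ?case using generate.one[of "G \<times>\<times> circle"] by (auto simp: graph_def)
next
  case (incl h)
  then show ?case by (auto simp: graph_def intro: generate.incl)
next
  case (inv h)
  then obtain v where v: "v \<in> D" "h = s v" by auto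
  then have "inv\<^bsub>G \<times>\<times> circle\<^esub> (s v, x v) \<in> graph x D" by (auto simp: graph_def intro: generate.inv)
  moreover have "s v \<in> carrier G" using v D s_closed by auto
  ultimately show ?case using v norm_x by auto
next
  case (eng g h)
  then obtain y z where "(g, y) \<in> graph x D" "(h, z) \<in> graph x D" by blast
  then have "(g, y) \<otimes>\<^bsub>G \<times>\<times> circle\<^esub> (h, z) \<in> graph x D" unfolding graph_def by (rule generate.eng)
  then show ?case by auto
qed

lemma fst_graph:
  assumes D: "D \<subseteq> \<Lambda>" and g: "(g, y) \<in> graph x D"
  shows "g \<in> generate G (s ` D)"
proof -
  have "fst p \<in> generate G (s ` D)" if "p \<in> graph x D" for p
    using that unfolding graph_def
  proof induction
    case (inv p)
    then obtain v where v: "v \<in> D" "p = (s v, x v)" by auto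
    then have "s v \<in> carrier G" using D s_closed by auto
    then have "inv\<^bsub>G \<times>\<times> circle\<^esub> p = (inv (s v), inverse (x v))" using v norm_x by simp
    then show ?case using v by (auto intro: generate.inv)
  qed (auto simp: mult_DirProd' intro: generate.intros)
  then show ?thesis using g by force
qed

text \<open>A subgroup of the product is the graph of a function as soon as it has only one element
  over the unit: two values over the same \<open>g\<close> differ by a value over
  \<open>\<one>\<close>.\<close>

definition functional :: "'w set \<Rightarrow> bool" where
  "functional D \<longleftrightarrow> (\<forall>y. (\<one>, y) \<in> graph x D \<longrightarrow> y = 1)"

lemma functional_unique:
  assumes D: "D \<subseteq> \<Lambda>" and f: "functional D" and g: "(g, y) \<in> graph x D" "(g, z) \<in> graph x D"
  shows "y = z"
proof -
  note S = subgroup_graph[OF D]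
  have "{(g, y), (g, z)} \<subseteq> carrier (G \<times>\<times> circle)" using g subgroup.subset[OF S] by blast
  then have c: "g \<in> carrier G" "norm y = 1" "norm z = 1" by auto
  have "(g, y) \<otimes>\<^bsub>G \<times>\<times> circle\<^esub> inv\<^bsub>G \<times>\<times> circle\<^esub> (g, z) \<in> graph x D"
    by (intro subgroup.m_closed[OF S] subgroup.m_inv_closed[OF S] g)
  then have "(\<one>, y * inverse z) \<in> graph x D" using c by simp
  moreover have "z \<noteq> 0" using c(3) by auto
  ultimately have "z \<noteq> 0 \<and> y * inverse z = 1" using f by (simp add: functional_def)
  then show ?thesis by (simp add: right_inverse_eq flip: divide_inverse)
qed

text \<open>The new generator satisfies only the relations that follow from the one for
  \<open>s w [^] d w\<close>. An element over \<open>\<one>\<close> is some \<open>p\<close> from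
  the old graph times a \<open>k\<close>-th power of \<open>(s w, x w)\<close>. Then
  \<open>s w [^] k\<close> lies in the old subgroup, so \<open>d w\<close> divides \<open>k\<close>,
  and the compatibility of \<open>x w\<close> with the old value at \<open>s w [^] d w\<close> puts
  the power into the old graph.\<close>

lemma functional_below_eq:
  assumes w: "w \<in> \<Lambda>" and f: "functional (below w)"
    and x: "\<And>y. (s w [^] d w, y) \<in> graph x (below w) \<Longrightarrow> x w ^ d w = y"
  shows "functional (below_eq w)"
  unfolding functional_def
proof (intro allI impI)
  fix y assume y: "(\<one>, y) \<in> graph x (below_eq w)"
  have sub: "below w \<subseteq> \<Lambda>" by auto
  note S = subgroup_graph[OF sub]
  have sw: "s w \<in> carrier G" using w s_closed by auto
  have "below_eq w = insert w (below w)" using w by auto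
  then have "(\<one>, y) \<in> generate (G \<times>\<times> circle) (insert (s w, x w) ((\<lambda>v. (s v, x v)) ` below w))"
    using y by (simp add: graph_def)
  then obtain p k where p: "p \<in> graph x (below w)" "(\<one>, y) = p \<otimes>\<^bsub>G \<times>\<times> circle\<^esub> (s w, x w) [^]\<^bsub>G \<times>\<times> circle\<^esub> (k::int)"
    using P.generate_insert[of "(s w, x w)" "(\<lambda>v. (s v, x v)) ` below w" "(\<one>, y)"] graph_closed[OF sub] sw norm_x
    unfolding graph_def by auto
  obtain h z where hz: "p = (h, z)" by force
  have h: "h \<in> generate G (s ` below w)" using fst_graph[OF sub] p(1) hz by simp
  have "s ` below w \<subseteq> carrier G" using s_closed by auto
  note H = generate_is_subgroup[OF this]
  have eq: "\<one> = h \<otimes> s w [^] k" "y = z * x w powi k"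
    using p(2) sw norm_x by (auto simp: hz int_pow_DirProd_circle)
  have "s w [^] k = inv h" using eq(1) sw subgroup.mem_carrier[OF H h]
    by (metis inv_equality int_pow_closed m_comm)
  then have "s w [^] k \<in> generate G (s ` below w)" using subgroup.m_inv_closed[OF H h] by simp
  then obtain j where j: "k = int (d w) * j" using pow_mem_iff[OF w] by (auto elim: dvdE)
  obtain y0 where y0: "(s w [^] d w, y0) \<in> graph x (below w)"
    using graph_total[OF sub pow_order_mem[OF w]] by blast
  have xw: "x w ^ d w = y0" using x y0 .
  have "norm y0 = 1" using xw norm_x by (auto simp: norm_power)
  have "(s w [^] d w, y0) [^]\<^bsub>G \<times>\<times> circle\<^esub> j \<in> graph x (below w)"
    using P.subgroup_int_pow_closed[OF S y0] .
  then have "p \<otimes>\<^bsub>G \<times>\<times> circle\<^esub> (s w [^] d w, y0) [^]\<^bsub>G \<times>\<times> circle\<^esub> j \<in> graph x (below w)"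
    by (intro subgroup.m_closed[OF S] p(1))
  moreover have "(s w [^] d w) [^] j = s w [^] k" using sw by (simp add: j int_pow_pow flip: int_pow_int)
  moreover have "y0 powi j = x w powi k" by (simp add: xw[symmetric] j power_int_mult)
  ultimately have "(\<one>, y) \<in> graph x (below w)"
    using sw \<open>norm y0 = 1\<close> eq by (simp add: hz int_pow_DirProd_circle)
  then show "y = 1" using f by (simp add: functional_def)
qed

text \<open>\<open>D\<close> is an initial segment. A relation that breaks functionality would
  involve a last generator \<open>w\<close>, so it would already occur in
  \<open>below_eq w\<close>.\<close>

lemma functional_Union:
  assumes D: "D \<subseteq> \<Lambda>" "\<And>v w. w \<in> D \<Longrightarrow> v \<in> \<Lambda> \<Longrightarrow> (v, w) \<in> R \<Longrightarrow> v \<in> D"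
    and f: "\<And>w. w \<in> D \<Longrightarrow> functional (below_eq w)"
  shows "functional D"
  unfolding functional_def
proof (intro allI impI)
  fix y assume "(\<one>, y) \<in> graph x D"
  then have "(\<one>, y) = \<one>\<^bsub>G \<times>\<times> circle\<^esub> \<or>
      (\<exists>w\<in>D. (\<one>, y) \<in> generate (G \<times>\<times> circle) ((\<lambda>v. (s v, x v)) ` {v\<in>D. v = w \<or> (v, w) \<in> R}))"
    unfolding graph_def
    by (intro P.generate_total_cases trans graph_closed D total_on_subset[OF total])
  then show "y = 1"
  proof
    assume "\<exists>w\<in>D. (\<one>, y) \<in> generate (G \<times>\<times> circle) ((\<lambda>v. (s v, x v)) ` {v\<in>D. v = w \<or> (v, w) \<in> R})"
    then obtain w where w: "w \<in> D" "(\<one>, y) \<in> graph x {v\<in>D. v = w \<or> (v, w) \<in> R}"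
      by (auto simp: graph_def)
    have "{v\<in>D. v = w \<or> (v, w) \<in> R} = below_eq w" using D w(1) by auto
    then show ?thesis using w f[OF w(1)] by (simp add: functional_def)
  qed simp
qed

text \<open>Transfinite induction: \<open>functional_Union\<close> passes from the segments
  \<open>below_eq v\<close> of all predecessors to \<open>below w\<close>, with or without a last
  predecessor, and \<open>functional_below_eq\<close> then adds \<open>w\<close>.\<close>

lemma functional_all:
  assumes "\<And>w y. w \<in> \<Lambda> \<Longrightarrow> functional (below w) \<Longrightarrow> (s w [^] d w, y) \<in> graph x (below w) \<Longrightarrow> x w ^ d w = y"
  shows "functional \<Lambda>" "w \<in> \<Lambda> \<Longrightarrow> functional (below w)"
proof -
  have *: "w \<in> \<Lambda> \<longrightarrow> functional (below_eq w)" for w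
    using wf
  proof (induction w rule: wf_induct_rule)
    case (less w)
    have "functional (below w)" if "w \<in> \<Lambda>"
      by (rule functional_Union) (use less trans in \<open>auto dest: transD\<close>)
    then show ?case using assms functional_below_eq by blast
  qed
  show "functional \<Lambda>" by (rule functional_Union) (use * in auto)
  show "functional (below w)" if "w \<in> \<Lambda>" 
    by (rule functional_Union) (use * trans in \<open>auto dest: transD\<close>)
qed

end

text \<open>\<open>\<rho> w y\<close> is a rule that picks the value at \<open>s w\<close> once the
  value \<open>y\<close> at \<open>s w [^] d w\<close> is known. As it returns a
  \<open>d w\<close>-th root of \<open>y\<close>, the recursion never meets a contradictory
  relation, and the graph over all of \<open>\<Lambda>\<close> is that of a character.\<close>

theorem exists_character:
  assumes \<rho>: "\<And>w y. norm (\<rho> w y) = 1"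
    and root: "\<And>w y. w \<in> \<Lambda> \<Longrightarrow> norm y = 1 \<Longrightarrow> d w > 0 \<Longrightarrow> \<rho> w y ^ d w = y"
  obtains \<phi> where "\<phi> \<in> hom G circle" "\<And>w. w \<in> \<Lambda> \<Longrightarrow> \<phi> (s w) = \<rho> w (\<phi> (s w [^] d w))"
proof -
  \<comment> \<open>The definite description is the value at \<open>s w [^] d w\<close> forced by
    the values at the predecessors; it is meaningful once \<open>below w\<close> is known to be
    functional. Only the values of \<open>x\<close> on \<open>below w\<close> enter, so the
    recursion is well founded.\<close>
  define F where "F = (\<lambda>x w. \<rho> w (THE y. (s w [^] d w, y) \<in> graph x (below w)))"
  define x where "x = wfrec R F"
  have "adm_wf R F" unfolding adm_wf_def F_def
    by (intro allI impI arg_cong[where f="\<rho> _"] arg_cong[where f=The] ext arg_cong2[where f="(\<in>)"] graph_cong) auto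
  then have x: "x w = \<rho> w (THE y. (s w [^] d w, y) \<in> graph x (below w))" for w
    unfolding x_def by (subst wfrec_fixpoint[OF wf]) (simp_all add: F_def)
  have norm_x: "norm (x v) = 1" for v by (subst x) (rule \<rho>)
  note fu = functional_unique[where x=x, OF norm_x]
  have xw: "x w = \<rho> w y" if w: "w \<in> \<Lambda>" "functional x (below w)" "(s w [^] d w, y) \<in> graph x (below w)" for w y
  proof -
    have "(THE y. (s w [^] d w, y) \<in> graph x (below w)) = y"
      using w fu[of "below w"] by (intro the_equality) auto
    then show ?thesis by (subst x) simp
  qed
  have pw: "x w ^ d w = y"
    if w: "w \<in> \<Lambda>" "functional x (below w)" "(s w [^] d w, y) \<in> graph x (below w)" for w y
  proof (cases "d w > 0")
    case True
    have "norm y = 1" using subgroup.subset[OF subgroup_graph[where x=x, OF norm_x, of "below w"]] w(3) by auto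
    then show ?thesis using xw[OF w] root w(1) True by simp
  next
    case False
    \<comment> \<open>Here \<open>d w = 0\<close>, so the power is \<open>\<one>\<close> and
      functionality forces \<open>y = 1\<close>.\<close>
    then show ?thesis using w norm_x by (simp add: functional_def)
  qed
  note fall = functional_all[where x=x, OF norm_x pw]
  define \<phi> where "\<phi> g = (THE y. (g, y) \<in> graph x \<Lambda>)" for g
  have eqI: "\<phi> g = y" if "(g, y) \<in> graph x \<Lambda>" for g y
    unfolding \<phi>_def using that fu[OF _ fall(1)] by blast
  have mem: "(g, \<phi> g) \<in> graph x \<Lambda>" if "g \<in> carrier G" for g
    using graph_total[where x=x, OF norm_x, of \<Lambda> g] that eqI s_generate by auto
  note S = subgroup_graph[where x=x, OF norm_x order.refl]
  show thesis
  proof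
    show "\<phi> \<in> hom G circle"
    proof (rule homI)
      fix g assume "g \<in> carrier G" then show "\<phi> g \<in> carrier circle"
        using subgroup.mem_carrier[OF S mem] by fastforce
    next
      fix g h assume "g \<in> carrier G" "h \<in> carrier G"
      then show "\<phi> (g \<otimes> h) = \<phi> g \<otimes>\<^bsub>circle\<^esub> \<phi> h"
        using subgroup.m_closed[OF S mem mem, of g h] by (intro eqI) simp
    qed
  next
    fix w assume w: "w \<in> \<Lambda>"
    obtain y where y: "(s w [^] d w, y) \<in> graph x (below w)"
      using graph_total[where x=x, OF norm_x _ pow_order_mem[OF w]] by auto
    have "graph x (below w) \<subseteq> graph x \<Lambda>"
      unfolding graph_def by (intro P.mono_generate image_mono) auto
    then have "\<phi> (s w [^] d w) = y" using y by (intro eqI) auto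
    moreover have "\<phi> (s w) = x w"
      using w by (intro eqI) (auto simp: graph_def intro: generate.incl)
    ultimately show "\<phi> (s w) = \<rho> w (\<phi> (s w [^] d w))"
      using xw[OF w fall(2)[OF _ _ _ w] y] by simp
  qed
qed

end

section \<open>Families of characters with approximate targets and separating switches\<close>

context transfinite_generators
begin

lemma below_eq_subset_below: "v \<in> below w \<Longrightarrow> below_eq v \<subseteq> below w"
  using trans by (auto dest: transD)

text \<open>\<open>t w i\<close> is the target for the value at \<open>s w\<close>, and
  \<open>q w i\<close> is a switch: it decides whether the root nearest in kind to the target is
  multiplied by a small element \<open>\<omega> w\<close> of order \<open>d w\<close>. The error is
  at most \<open>pi / m w\<close> from the root plus \<open>2 * pi / m w\<close> from the switch.
  The assumption on \<open>q\<close> lets one switch be flipped while finitely many entries and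
  finitely many other switches stay fixed.\<close>

theorem exists_separating_characters:
  fixes I :: "(nat \<Rightarrow> 'x) set" and t :: "'w \<Rightarrow> (nat \<Rightarrow> 'x) \<Rightarrow> complex" and m :: "'w \<Rightarrow> nat"
    and q :: "'w \<Rightarrow> (nat \<Rightarrow> 'x) \<Rightarrow> bool"
  assumes t: "\<And>w i. norm (t w i) = 1"
    and t_cong: "\<And>w. \<exists>N. \<forall>i i'. (\<forall>n<N. i n = i' n) \<longrightarrow> t w i = t w i'"
    and m: "\<And>w. w \<in> \<Lambda> \<Longrightarrow> m w > 0" "\<And>w. w \<in> \<Lambda> \<Longrightarrow> d w = 0 \<or> m w \<le> d w"
    and q: "\<And>w E N. w \<in> \<Lambda> \<Longrightarrow> finite E \<Longrightarrow> E \<subseteq> \<Lambda> - {w} \<Longrightarrow>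
      \<exists>i\<in>I. \<exists>i'\<in>I. (\<forall>n<N. i n = i' n) \<and> (\<forall>v\<in>E. q v i = q v i') \<and> q w i \<and> \<not> q w i'"
  obtains \<phi> where "\<And>i. \<phi> i \<in> hom G circle"
    "\<And>w i. w \<in> \<Lambda> \<Longrightarrow> norm (\<phi> i (s w) - t w i) \<le> 3 * pi / real (m w)"
    "\<And>g. g \<in> carrier G \<Longrightarrow> g \<noteq> \<one> \<Longrightarrow> \<exists>i\<in>I. \<phi> i g \<noteq> 1"
proof -
  define near where "near w u y x \<longleftrightarrow>
      norm x = 1 \<and> (d w > 0 \<longrightarrow> x ^ d w = y) \<and> norm (x - u) \<le> pi / real (m w)" for w and u y x :: complex
  \<comment> \<open>The choice is made once for \<open>w\<close>, \<open>u\<close> and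
    \<open>y\<close>, so \<open>i\<close> influences the value at \<open>s w\<close> only through
    the target, the switch and the value at \<open>s w [^] d w\<close>. The finite dependence proved
    below rests on this.\<close>
  define nr where "nr w u y = (SOME x. near w u y x)" for w u y
  have nr: "near w u y (nr w u y)" if "w \<in> \<Lambda>" "norm y = 1" "norm u = 1" for w u y
    unfolding nr_def near_def by (rule someI_ex[OF exists_near_root[OF m(1,2)[OF that(1)] that(2,3)]])
  have "\<forall>w\<in>\<Lambda>. \<exists>z::complex. norm z = 1 \<and> z ^ d w = 1 \<and> (\<forall>k::int. z powi k = 1 \<longrightarrow> int (d w) dvd k)
      \<and> norm (z - 1) \<le> 2 * pi / real (m w)"
    using exists_small_of_order[OF m] by (rule ballI)
  from bchoice[OF this] obtain \<omega> :: "'w \<Rightarrow> complex" where \<omega>: "\<And>w. w \<in> \<Lambda> \<Longrightarrow> norm (\<omega> w) = 1"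
    "\<And>w. w \<in> \<Lambda> \<Longrightarrow> \<omega> w ^ d w = 1"
    "\<And>w k. w \<in> \<Lambda> \<Longrightarrow> \<omega> w powi k = 1 \<Longrightarrow> int (d w) dvd k"
    "\<And>w. w \<in> \<Lambda> \<Longrightarrow> norm (\<omega> w - 1) \<le> 2 * pi / real (m w)" by blast
  \<comment> \<open>Since \<open>\<omega> w ^ d w = 1\<close>, the switched value is still a root.
    The default \<open>1\<close> gives the rule norm one for all arguments, as
    \<open>exists_character\<close> demands.\<close>
  define \<rho> where "\<rho> i w y = (if w \<in> \<Lambda> \<and> norm y = 1
    then nr w (t w i) y * (if q w i then \<omega> w else 1) else 1)" for i w y
  have "\<exists>\<phi>. \<phi> \<in> hom G circle \<and> (\<forall>w\<in>\<Lambda>. \<phi> (s w) = \<rho> i w (\<phi> (s w [^] d w)))" for i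
  proof (rule exists_character[of "\<rho> i"])
    show "norm (\<rho> i w y) = 1" for w y using nr[of w y "t w i"] t \<omega>(1)[of w]
      by (simp add: \<rho>_def norm_mult near_def)
    show "\<rho> i w y ^ d w = y" if "w \<in> \<Lambda>" "norm y = 1" "d w > 0" for w y
      using nr[OF that(1,2) t] \<omega>(2)[OF that(1)] that by (simp add: \<rho>_def power_mult_distrib near_def)
  qed blast
  then have "\<forall>i. \<exists>\<phi>. \<phi> \<in> hom G circle \<and> (\<forall>w\<in>\<Lambda>. \<phi> (s w) = \<rho> i w (\<phi> (s w [^] d w)))" by blast
  from choice[OF this] obtain \<phi> where hom: "\<And>i. \<phi> i \<in> hom G circle"
    and \<phi>: "\<And>i w. w \<in> \<Lambda> \<Longrightarrow> \<phi> i (s w) = \<rho> i w (\<phi> i (s w [^] d w))" by blast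
  have norm: "norm (\<phi> i g) = 1" if "g \<in> carrier G" for i g
    using hom_in_carrier[OF hom that] by simp
  have sG: "s w \<in> carrier G" if "w \<in> \<Lambda>" for w using s_closed that by blast
  have \<phi>s: "\<phi> i (s w) = nr w (t w i) (\<phi> i (s w [^] d w)) * (if q w i then \<omega> w else 1)"
    if "w \<in> \<Lambda>" for i w
    using \<phi>[OF that, of i] norm[of "s w [^] d w" i] sG[OF that] that by (simp add: \<rho>_def)
  \<comment> \<open>By the recursion for \<^term>\<open>\<phi> i (s w)\<close>, each value depends on finitely many entries of \<^term>\<open>i\<close> and
    finitely many switches \<^term>\<open>q v i\<close>.\<close>
  define determined where "determined D h \<longleftrightarrow> (\<exists>N E. finite E \<and> E \<subseteq> D \<and>
    (\<forall>i i'. (\<forall>n<N. i n = i' n) \<longrightarrow> (\<forall>v\<in>E. q v i = q v i') \<longrightarrow> \<phi> i h = \<phi> i' h))" for D h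
  have determined_mono: "determined D' h" if "determined D h" "D \<subseteq> D'" for D D' h
    using that unfolding determined_def by (meson order_trans)
  have determined_generate: "determined D h"
    if D: "D \<subseteq> \<Lambda>" "\<And>v. v \<in> D \<Longrightarrow> determined D (s v)" and h: "h \<in> generate G (s ` D)" for D h
    using h
  proof induction
    case one
    have "\<phi> i \<one> = 1" for i using hom_one[OF hom is_group circle.is_group, of i] by simp
    then show ?case unfolding determined_def by (intro exI[of _ 0] exI[of _ "{}"]) simp
  next
    case (incl h)
    then show ?case using D(2) by blast
  next
    case (inv h)
    then have "determined D h" "h \<in> carrier G" using D sG by auto
    moreover have "\<phi> i (inv h) = inverse (\<phi> i h)" for i
    proof -
      interpret group_hom G circle "\<phi> i"
        by (simp add: group_hom_def group_hom_axioms_def hom circle.is_group is_group)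
      show ?thesis using hom_inv[OF \<open>h \<in> carrier G\<close>] norm[OF \<open>h \<in> carrier G\<close>] by simp
    qed
    ultimately show ?case unfolding determined_def by simp
  next
    case (eng h h')
    obtain N E where NE: "finite E" "E \<subseteq> D"
      "\<And>i i'. (\<forall>n<N. i n = i' n) \<Longrightarrow> (\<forall>v\<in>E. q v i = q v i') \<Longrightarrow> \<phi> i h = \<phi> i' h"
      using eng.IH(1) unfolding determined_def by blast
    obtain N' E' where NE': "finite E'" "E' \<subseteq> D"
      "\<And>i i'. (\<forall>n<N'. i n = i' n) \<Longrightarrow> (\<forall>v\<in>E'. q v i = q v i') \<Longrightarrow> \<phi> i h' = \<phi> i' h'"
      using eng.IH(2) unfolding determined_def by blast
    have "s ` D \<subseteq> carrier G" using D sG by blast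
    then have c: "h \<in> carrier G" "h' \<in> carrier G" using eng.hyps generate_in_carrier by blast+
    have "\<phi> i (h \<otimes> h') = \<phi> i' (h \<otimes> h')"
      if "\<forall>n<max N N'. i n = i' n" "\<forall>v\<in>E \<union> E'. q v i = q v i'" for i i'
      using that NE(3)[of i i'] NE'(3)[of i i'] by (simp add: hom_mult[OF hom c])
    then show ?case unfolding determined_def using NE(1,2) NE'(1,2)
      by (intro exI[of _ "max N N'"] exI[of _ "E \<union> E'"]) blast
  qed
  have determined_s: "w \<in> \<Lambda> \<longrightarrow> determined (below_eq w) (s w)" for w
    using wf
  proof (induction w rule: wf_induct_rule)
    case (less w)
    show ?case
    proof
      assume w: "w \<in> \<Lambda>"
      have *: "determined (below w) (s v)" if v: "v \<in> below w" for v
        using less.IH[of v] v by (auto intro: determined_mono[OF _ below_eq_subset_below[OF v]])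
      have "determined (below w) (s w [^] d w)"
        by (rule determined_generate[OF _ * pow_order_mem[OF w]]) auto
      then obtain N E where NE: "finite E" "E \<subseteq> below w"
        "\<And>i i'. (\<forall>n<N. i n = i' n) \<Longrightarrow> (\<forall>v\<in>E. q v i = q v i') \<Longrightarrow> \<phi> i (s w [^] d w) = \<phi> i' (s w [^] d w)"
        unfolding determined_def by blast
      obtain N' where N': "\<And>i i'. (\<forall>n<N'. i n = i' n) \<Longrightarrow> t w i = t w i'" using t_cong by blast
      have "\<phi> i (s w) = \<phi> i' (s w)"
        if "\<forall>n<max N N'. i n = i' n" "\<forall>v\<in>insert w E. q v i = q v i'" for i i'
        using that NE(3)[of i i'] N'[of i i'] by (simp add: \<phi>s[OF w])
      then show "determined (below_eq w) (s w)" unfolding determined_def using NE(1,2) w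
        by (intro exI[of _ "max N N'"] exI[of _ "insert w E"]) blast
    qed
  qed
  have determined_below: "determined (below w) h" if "h \<in> generate G (s ` below w)" for w h
  proof (rule determined_generate[OF _ _ that])
    show "determined (below w) (s v)" if v: "v \<in> below w" for v
      using determined_s[of v] v by (auto intro: determined_mono[OF _ below_eq_subset_below[OF v]])
  qed auto
  show thesis
  proof
    show "\<phi> i \<in> hom G circle" for i by (rule hom)
  next
    fix w i assume w: "w \<in> \<Lambda>"
    define x where "x = nr w (t w i) (\<phi> i (s w [^] d w))"
    have x: "norm x = 1" "norm (x - t w i) \<le> pi / m w"
      using nr[OF w, of "\<phi> i (s w [^] d w)" "t w i"] norm[of "s w [^] d w" i] t[of w i] sG[OF w]
      by (auto simp: x_def near_def)
    show "norm (\<phi> i (s w) - t w i) \<le> 3 * pi / real (m w)"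
    proof (cases "q w i")
      case True
      have "\<phi> i (s w) - t w i = x * (\<omega> w - 1) + (x - t w i)"
        using True by (simp add: \<phi>s[OF w] x_def algebra_simps)
      then have "norm (\<phi> i (s w) - t w i) \<le> norm (x * (\<omega> w - 1)) + norm (x - t w i)"
        by (simp only: norm_triangle_ineq)
      also have "\<dots> \<le> 2 * pi / m w + pi / m w"
        using x \<omega>(4)[OF w] by (intro add_mono) (auto simp: norm_mult)
      finally show ?thesis by (simp add: field_simps)
    next
      case False
      have "pi / m w \<le> 3 * pi / m w" by (intro divide_right_mono) auto
      then show ?thesis using False x(2) by (simp add: \<phi>s[OF w] x_def[symmetric])
    qed
  next
    fix g assume g: "g \<in> carrier G" "g \<noteq> \<one>"
    \<comment> \<open>\<^term>\<open>w\<close> is the last generator occurring in \<^term>\<open>g\<close>, so only the switch of \<^term>\<open>w\<close> acts on \<^term>\<open>s w\<close>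
      while the contribution of the earlier generators is fixed by the switches below \<^term>\<open>w\<close>.\<close>
    let ?Q = "{w\<in>\<Lambda>. g \<in> generate G (s ` below_eq w)}"
    have "\<exists>w\<in>\<Lambda>. g \<in> generate G (s ` below_eq w)"
      using generate_total_cases[OF trans total, of g s] g s_generate s_closed by auto
    then obtain w0 where "w0 \<in> ?Q" by blast
    then obtain w where w: "w \<in> ?Q" "\<And>v. (v, w) \<in> R \<Longrightarrow> v \<notin> ?Q"
      using wfE_min[OF wf, of w0 ?Q] by blast
    then have w\<Lambda>: "w \<in> \<Lambda>" by simp
    have s_below: "s ` below w \<subseteq> carrier G" using s_closed by auto
    have not_below: "g \<notin> generate G (s ` below w)"
    proof
      assume "g \<in> generate G (s ` below w)"
      from generate_total_cases[OF trans total_on_subset[OF total] this s_below] g(2)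
      obtain v where v: "v \<in> below w" "g \<in> generate G (s ` {u\<in>below w. u = v \<or> (u, v) \<in> R})" by auto
      moreover have "generate G (s ` {u\<in>below w. u = v \<or> (u, v) \<in> R}) \<subseteq> generate G (s ` below_eq v)"
        by (intro mono_generate image_mono) auto
      ultimately show False using w(2)[of v] by blast
    qed
    have "below_eq w = insert w (below w)" using w\<Lambda> by auto
    then have "g \<in> generate G (insert (s w) (s ` below w))" using w(1) by simp
    then obtain h k where hk: "h \<in> generate G (s ` below w)" "g = h \<otimes> s w [^] (k::int)"
      by (rule generate_insert[OF sG[OF w\<Lambda>] s_below])
    have "\<not> int (d w) dvd k"
    proof
      assume "int (d w) dvd k"
      then have "s w [^] k \<in> generate G (s ` below w)" using pow_mem_iff[OF w\<Lambda>] by simp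
      then show False using not_below hk generate.eng by metis
    qed
    then have \<omega>k: "\<omega> w powi k \<noteq> 1" using \<omega>(3)[OF w\<Lambda>] by blast
    obtain N1 E1 where 1: "finite E1" "E1 \<subseteq> below w"
      "\<And>i i'. (\<forall>n<N1. i n = i' n) \<Longrightarrow> (\<forall>v\<in>E1. q v i = q v i') \<Longrightarrow> \<phi> i h = \<phi> i' h"
      using determined_below[OF hk(1)] unfolding determined_def by blast
    obtain N2 E2 where 2: "finite E2" "E2 \<subseteq> below w"
      "\<And>i i'. (\<forall>n<N2. i n = i' n) \<Longrightarrow> (\<forall>v\<in>E2. q v i = q v i') \<Longrightarrow> \<phi> i (s w [^] d w) = \<phi> i' (s w [^] d w)"
      using determined_below[OF pow_order_mem[OF w\<Lambda>]] unfolding determined_def by blast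
    obtain N3 where 3: "\<And>i i'. (\<forall>n<N3. i n = i' n) \<Longrightarrow> t w i = t w i'" using t_cong by blast
    have "(w, w) \<notin> R" using wf by (rule wf_irrefl)
    then have "E1 \<union> E2 \<subseteq> \<Lambda> - {w}" using 1(2) 2(2) by auto
    from q[OF w\<Lambda> _ this] 1(1) 2(1)
    obtain i i' where i: "i \<in> I" "i' \<in> I" "\<forall>n<max N1 (max N2 N3). i n = i' n"
      "\<forall>v\<in>E1 \<union> E2. q v i = q v i'" "q w i" "\<not> q w i'" by blast
    have eq: "\<phi> i h = \<phi> i' h" "\<phi> i (s w [^] d w) = \<phi> i' (s w [^] d w)" "t w i = t w i'"
      by (rule 1(3) 2(3) 3; use i in simp)+
    have step: "\<phi> i (s w) = \<phi> i' (s w) * \<omega> w"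
      using i eq by (simp add: \<phi>s[OF w\<Lambda>])
    have hG: "h \<in> carrier G" using generate_in_carrier[OF s_below hk(1)] .
    have \<phi>g: "\<phi> j g = \<phi> j h * \<phi> j (s w) powi k" for j
    proof -
      interpret group_hom G circle "\<phi> j"
        by (simp add: group_hom_def group_hom_axioms_def hom circle.is_group is_group)
      show ?thesis using hG sG[OF w\<Lambda>] norm[OF sG[OF w\<Lambda>]] by (simp add: hk(2) hom_int_pow)
    qed
    \<comment> \<open>Flipping the switch changes the value at \<open>g\<close> by a factor other
      than \<open>1\<close>, so the two values cannot both be \<open>1\<close>.\<close>
    have "\<phi> i g = \<phi> i' g * \<omega> w powi k"
      by (simp add: \<phi>g step eq(1) power_int_mult_distrib)
    then have "\<phi> i g \<noteq> 1 \<or> \<phi> i' g \<noteq> 1" using \<omega>k by auto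
    then show "\<exists>i\<in>I. \<phi> i g \<noteq> 1" using i(1,2) by blast
  qed
qed

end

section \<open>Finite and tail conditions on sequences of sets\<close>

text \<open>A literal \<open>(n, x, b)\<close> prescribes the bit that tells whether
  \<open>x\<close> belongs to the \<open>n\<close>-th set. A list of literals, read as a
  conjunction, is a basic open set of the Cantor cube of sequences of sets.\<close>

type_synonym 't literals = "(nat \<times> 't \<times> bool) list"

definition literals_over :: "'t set \<Rightarrow> 't literals set" where
  "literals_over W = lists (UNIV \<times> W \<times> UNIV)"

definition literals_hold :: "'t literals \<Rightarrow> (nat \<Rightarrow> 't set) \<Rightarrow> bool" where
  "literals_hold c i \<longleftrightarrow> (\<forall>(n, x, b)\<in>set c. x \<in> i n \<longleftrightarrow> b)"

text \<open>A locally constant function on the Cantor cube, described by finite data. Conditions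
  that hold together contribute all their factors, so every list is admissible and no partition of
  the cube has to be recorded.\<close>

definition step_value :: "nat \<Rightarrow> ('t literals \<times> int) list \<Rightarrow> (nat \<Rightarrow> 't set) \<Rightarrow> complex" where
  "step_value m L i = (\<Prod>(c, p)\<leftarrow>L. if literals_hold c i then cis (of_int p / real m) else 1)"

lemma norm_step_value: "norm (step_value m L i) = 1"
  unfolding step_value_def by (induction L) (auto simp: norm_mult)

lemma literals_hold_cong:
  "\<exists>N. \<forall>i i'. (\<forall>n<N. i n = i' n) \<longrightarrow> literals_hold c i = literals_hold c i'"
proof (induction c)
  case Nil
  then show ?case by (simp add: literals_hold_def)
next
  case (Cons a c)
  then obtain N where N: "\<And>i i'. (\<forall>n<N. i n = i' n) \<Longrightarrow> literals_hold c i = literals_hold c i'" by blast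
  obtain n x b where a: "a = (n, x, b)" by (cases a)
  have "literals_hold (a # c) i = literals_hold (a # c) i'"
    if "\<forall>k<max N (Suc n). i k = i' k" for i i'
    using that N[of i i'] by (simp add: literals_hold_def a)
  then show ?case by blast
qed

lemma step_value_cong:
  "\<exists>N. \<forall>i i'. (\<forall>n<N. i n = i' n) \<longrightarrow> step_value m L i = step_value m L i'"
proof (induction L)
  case Nil
  then show ?case by (simp add: step_value_def)
next
  case (Cons a L)
  then obtain N where N: "\<And>i i'. (\<forall>n<N. i n = i' n) \<Longrightarrow> step_value m L i = step_value m L i'" by blast
  obtain M where M: "\<And>i i'. (\<forall>n<M. i n = i' n) \<Longrightarrow> literals_hold (fst a) i = literals_hold (fst a) i'"
    using literals_hold_cong by blast
  have "step_value m (a # L) i = step_value m (a # L) i'"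
    if "\<forall>k<max N M. i k = i' k" for i i'
    using that N[of i i'] M[of i i'] by (simp add: step_value_def case_prod_unfold)
  then show ?case by blast
qed

text \<open>Each other member of \<open>F\<close> differs from \<open>i\<close> in one bit, at a
  point of \<open>W\<close> because all entries are subsets of \<open>W\<close>. One such literal
  for each of these finitely many members does it.\<close>

lemma exists_isolating_literals:
  fixes F :: "(nat \<Rightarrow> 't set) set"
  assumes fin: "finite F" and F: "\<forall>i\<in>F. \<forall>n. i n \<subseteq> W" and i: "i \<in> F"
  shows "\<exists>c\<in>literals_over W. \<forall>j\<in>F. literals_hold c j \<longleftrightarrow> j = i"
proof -
  define P where "P j l \<longleftrightarrow> l \<in> UNIV \<times> W \<times> UNIV \<and>
    (case l of (n, x, b) \<Rightarrow> (x \<in> i n \<longleftrightarrow> b) \<and> \<not> (x \<in> j n \<longleftrightarrow> b))" for j :: "nat \<Rightarrow> 't set" and l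
  have "\<exists>l. P j l" if j: "j \<in> F" "j \<noteq> i" for j
  proof -
    obtain n where "i n \<noteq> j n" using j(2) by (auto simp: fun_eq_iff)
    then obtain x where "x \<in> i n \<longleftrightarrow> x \<notin> j n" by (auto simp: set_eq_iff)
    then have "P j (n, x, x \<in> i n)" using F i j(1) by (auto simp: P_def)
    then show ?thesis by blast
  qed
  then have "\<forall>j\<in>F - {i}. \<exists>l. P j l" by blast
  from bchoice[OF this] obtain l where l: "\<forall>j\<in>F - {i}. P j (l j)" by blast
  obtain c where c: "set c = l ` (F - {i})" using fin finite_list[of "l ` (F - {i})"] by blast
  have "literals_hold c i" unfolding literals_hold_def c
  proof
    fix a assume "a \<in> l ` (F - {i})"
    then obtain j where "a = l j" "P j a" using l by auto
    then show "case a of (n, x, b) \<Rightarrow> x \<in> i n \<longleftrightarrow> b" by (auto simp: P_def split_beta)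
  qed
  moreover have "\<not> literals_hold c j" if "j \<in> F" "j \<noteq> i" for j
  proof -
    have "P j (l j)" "l j \<in> set c" using l that by (auto simp: c)
    then show ?thesis unfolding literals_hold_def P_def by (auto simp: split_beta)
  qed
  moreover have "l j \<in> UNIV \<times> W \<times> UNIV" if "j \<in> F - {i}" for j using l that unfolding P_def by blast
  then have "set c \<subseteq> UNIV \<times> W \<times> UNIV" unfolding c by (rule image_subsetI)
  then have "c \<in> literals_over W" unfolding literals_over_def lists_eq_set by (rule CollectI)
  ultimately show ?thesis by blast
qed

text \<open>With conditions that isolate the members of \<open>F\<close> from each other, just one
  factor of the product survives at each member.\<close>

lemma exists_step_value:
  fixes p :: "(nat \<Rightarrow> 't set) \<Rightarrow> int"
  assumes fin: "finite F" and F: "\<forall>i\<in>F. \<forall>n. i n \<subseteq> W"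
  shows "\<exists>L\<in>lists (literals_over W \<times> UNIV). \<forall>i\<in>F. step_value m L i = cis (of_int (p i) / real m)"
proof -
  have "\<forall>i\<in>F. \<exists>c\<in>literals_over W. \<forall>j\<in>F. literals_hold c j \<longleftrightarrow> j = i"
    using exists_isolating_literals[where W=W, OF fin F] by blast
  from bchoice[OF this[unfolded Bex_def]] obtain c where c: "\<And>i. i \<in> F \<Longrightarrow> c i \<in> literals_over W"
    "\<And>i j. i \<in> F \<Longrightarrow> j \<in> F \<Longrightarrow> literals_hold (c i) j \<longleftrightarrow> j = i" by blast
  obtain js where js: "set js = F" "distinct js" using finite_distinct_list[OF fin] by blast
  define L where "L = map (\<lambda>i. (c i, p i)) js"
  have "step_value m L i = cis (of_int (p i) / real m)" if "i \<in> F" for i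
  proof -
    have "step_value m L i = (\<Prod>j\<leftarrow>js. if literals_hold (c j) i then cis (of_int (p j) / real m) else 1)"
      by (simp add: step_value_def L_def o_def)
    also have "\<dots> = (\<Prod>j\<in>F. if literals_hold (c j) i then cis (of_int (p j) / real m) else 1)"
      unfolding js(1)[symmetric] by (rule prod.distinct_set_conv_list[OF js(2), symmetric])
    also have "\<dots> = (\<Prod>j\<in>F. if i = j then cis (of_int (p j) / real m) else 1)"
      using c(2) that by (intro prod.cong) auto
    also have "\<dots> = cis (of_int (p i) / real m)" using fin that by (simp add: prod.delta)
    finally show ?thesis .
  qed
  moreover have "L \<in> lists (literals_over W \<times> UNIV)" using c(1) js by (auto simp: L_def)
  ultimately show ?thesis by blast
qed

section \<open>Counting the step data\<close>

lemma card_of_Times_ordLeq: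
  "infinite W \<Longrightarrow> |A| \<le>o |W| \<Longrightarrow> |B| \<le>o |W| \<Longrightarrow> |A \<times> B| \<le>o |W|"
  using card_of_Times_ordLeq_infinite_Field[of "|W|" A B] by (simp add: Field_card_of card_of_Card_order)

lemma card_of_lists_ordLeq:
  assumes "infinite W" "|A| \<le>o |W|"
  shows "|lists A| \<le>o |W|"
  using card_of_lists_mono[OF assms(2)] card_of_lists_infinite[OF assms(1)] by (rule ordLeq_ordIso_trans)

lemma card_of_countable_ordLeq:
  assumes "infinite W" "countable A"
  shows "|A| \<le>o |W|"
proof -
  have "|A| \<le>o |UNIV :: nat set|"
    using inj_on_to_nat_on[OF assms(2)] by (intro card_of_ordLeqI) auto
  moreover have "|UNIV :: nat set| \<le>o |W|" using assms(1) by (simp add: infinite_iff_card_of_nat)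
  ultimately show ?thesis by (rule ordLeq_transitive)
qed

text \<open>Forming finite lists and products with countable sets does not lead beyond the infinite
  cardinal of \<open>W\<close>. So the points of \<open>W\<close> can index all pairs of a precision
  and a step function, which is the counting behind the Hewitt-Marczewski-Pondiczery
  theorem.\<close>

lemma exists_step_data_enumeration:
  fixes W :: "'t set"
  assumes W: "infinite W"
  shows "\<exists>e :: 't \<Rightarrow> nat \<times> ('t literals \<times> int) list. UNIV \<times> lists (literals_over W \<times> UNIV) \<subseteq> e ` W"
proof -
  have "|UNIV \<times> lists (literals_over W \<times> (UNIV :: int set)) :: (nat \<times> ('t literals \<times> int) list) set| \<le>o |W|"
    unfolding literals_over_def
    by (intro card_of_Times_ordLeq card_of_lists_ordLeq card_of_countable_ordLeq W card_of_refl[THEN ordIso_imp_ordLeq]) auto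
  moreover have "(UNIV \<times> lists (literals_over W \<times> (UNIV :: int set)) :: (nat \<times> ('t literals \<times> int) list) set) \<noteq> {}" by auto
  ultimately obtain e :: "'t \<Rightarrow> nat \<times> ('t literals \<times> int) list"
    where "e ` W = UNIV \<times> lists (literals_over W \<times> (UNIV :: int set))"
    by (subst (asm) card_of_ordLeq2[symmetric]) auto
  then show ?thesis by blast
qed

text \<open>Even entries are test sets, odd entries record whether the preceding test set should belong to
  \<^term>\<open>A\<close>.  As only the tail counts, the condition is independent of any finite number of entries.\<close>

definition eventually_separates :: "'t set set \<Rightarrow> (nat \<Rightarrow> 't set) \<Rightarrow> bool" where
  "eventually_separates A i \<longleftrightarrow> (\<exists>N. \<forall>n\<ge>N. i (2 * n) \<in> A \<longleftrightarrow> i (2 * n + 1) \<noteq> {})"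

text \<open>Every \<open>B\<close> in \<open>E\<close> differs from \<open>A\<close> at some test
  set. The sequence \<open>i\<close> cycles through these test sets forever and answers as
  \<open>A\<close> does, so each \<open>B\<close> is contradicted infinitely often. The sequence
  \<open>i'\<close> contradicts itself and thus every set. All switches in \<open>E\<close> are off
  for both; a nonempty \<open>W\<close> serves as the answer yes.\<close>

lemma eventually_separates_independent:
  fixes A :: "'t set set"
  assumes W: "W \<noteq> {}" and A: "A \<subseteq> Pow W" and E: "finite E" "\<And>B. B \<in> E \<Longrightarrow> B \<subseteq> Pow W" "A \<notin> E"
  obtains i i' where "\<And>n. i n \<subseteq> W" "\<And>n. i' n \<subseteq> W" "\<And>n. n < N \<Longrightarrow> i n = i' n"
    "eventually_separates A i" "\<And>B. B \<in> insert A E \<Longrightarrow> \<not> eventually_separates B i'"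
    "\<And>B. B \<in> E \<Longrightarrow> \<not> eventually_separates B i"
proof -
  have "\<exists>X. X \<subseteq> W \<and> (X \<in> A \<longleftrightarrow> X \<notin> B)" if "B \<in> E" for B
  proof -
    have "B \<noteq> A" "B \<subseteq> Pow W" using E that by auto
    then obtain X where "X \<in> A \<longleftrightarrow> X \<notin> B" by (auto simp: set_eq_iff)
    then show ?thesis using A \<open>B \<subseteq> Pow W\<close> by blast
  qed
  then have "\<forall>B\<in>E. \<exists>X. X \<subseteq> W \<and> (X \<in> A \<longleftrightarrow> X \<notin> B)" by blast
  from bchoice[OF this] obtain X where X: "\<And>B. B \<in> E \<Longrightarrow> X B \<subseteq> W \<and> (X B \<in> A \<longleftrightarrow> X B \<notin> B)" by blast
  \<comment> \<open>The added \<open>{}\<close> keeps the list nonempty when \<open>E\<close> is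
    empty, so that \<open>f\<close> can run through it cyclically.\<close>
  obtain xs where xs: "set xs = insert {} (X ` E)" using finite_list[of "insert {} (X ` E)"] E by blast
  then have xs0: "length xs > 0" by auto
  define f where "f n = xs ! (n mod length xs)" for n
  define i where "i n = (if n < N then {} else if even n then f (n div 2)
     else if f (n div 2) \<in> A then W else {})" for n
  \<comment> \<open>Past \<open>N\<close> all test sets are \<open>{}\<close>, while the answers
    alternate between \<open>W\<close> and \<open>{}\<close>.\<close>
  define i' where "i' n = (if n < N \<or> n mod 4 \<noteq> 1 then {} else W)" for n :: nat
  have f: "f n \<in> set xs" for n using xs0 by (simp add: f_def)
  have fW: "f n \<subseteq> W" for n using f[of n] X unfolding xs by auto
  have "eventually_separates A i"
    unfolding eventually_separates_def using W by (intro exI[of _ N]) (auto simp: i_def)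
  moreover have "\<not> eventually_separates B i" if B: "B \<in> E" for B
  proof
    assume "eventually_separates B i"
    then obtain M where M: "\<And>n. n \<ge> M \<Longrightarrow> i (2 * n) \<in> B \<longleftrightarrow> i (2 * n + 1) \<noteq> {}"
      by (auto simp: eventually_separates_def)
    obtain k where k: "k < length xs" "xs ! k = X B" using B xs by (metis imageI in_set_conv_nth insertCI)
    \<comment> \<open>A position beyond both \<open>M\<close> and \<open>N\<close> at which the
      cycle shows the test set \<open>X B\<close>.\<close>
    define n where "n = k + (M + N) * length xs"
    have "M + N \<le> (M + N) * length xs" using xs0 by (cases "length xs") simp_all
    then have "M + N \<le> n" unfolding n_def by (rule trans_le_add2)
    then have "n \<ge> M" "n \<ge> N" by auto
    moreover have "f n = X B" using k by (simp add: f_def n_def)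
    ultimately show False using M[of n] X[OF B] W by (auto simp: i_def split: if_splits)
  qed
  moreover have "\<not> eventually_separates B i'" for B
  proof
    assume "eventually_separates B i'"
    then obtain M where M: "\<And>n. n \<ge> M \<Longrightarrow> i' (2 * n) \<in> B \<longleftrightarrow> i' (2 * n + 1) \<noteq> {}"
      by (auto simp: eventually_separates_def)
    define n where "n = 2 * (M + N)"
    have mod: "(2 * n) mod 4 \<noteq> 1" "(2 * n + 1) mod 4 = 1" "(2 * Suc n) mod 4 \<noteq> 1" "(2 * Suc n + 1) mod 4 \<noteq> 1"
      unfolding n_def by presburger+
    have "i' (2 * n) = {}" "i' (2 * Suc n) = {}" "i' (2 * Suc n + 1) = {}"
      using mod by (simp_all only: i'_def) auto
    moreover have "i' (2 * n + 1) = W"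
    proof -
      have "\<not> 2 * n + 1 < N" by (simp add: n_def)
      then show ?thesis unfolding i'_def using mod(2) by (simp only:) simp
    qed
    moreover have "n \<ge> M" "Suc n \<ge> M" by (simp_all add: n_def)
    ultimately show False using M[of n] M[of "Suc n"] W by auto
  qed
  moreover have "i n \<subseteq> W" for n using fW[of "n div 2"] by (simp add: i_def)
  moreover have "i' n \<subseteq> W" for n by (simp add: i'_def)
  moreover have "i n = i' n" if "n < N" for n using that by (simp add: i_def i'_def)
  ultimately show thesis by (intro that)
qed

text \<open>The bound on the cardinality of the group enters here: every generator, an index in
  \<open>Field \<tau>\<close> or an element of \<open>B\<close>, gets a set of subsets of
  \<open>Field \<tau>\<close> of its own, and with it a tail condition of its own.\<close>

lemma exists_double_power_code:
  assumes \<tau>: "Cinfinite \<tau>" and le: "|B| \<le>o ctwo ^c (ctwo ^c \<tau>)"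
  shows "\<exists>A. inj_on A (Field \<tau> <+> B) \<and> A ` (Field \<tau> <+> B) \<subseteq> Pow (Pow (Field \<tau>))"
proof -
  let ?\<kappa> = "ctwo ^c (ctwo ^c \<tau>)"
  have inf: "Cinfinite (ctwo ^c \<tau>)" "Cinfinite ?\<kappa>"
    using \<tau> by (auto intro!: Cinfinite_cexp ordLeq_refl Card_order_ctwo)
  have "\<tau> \<le>o ctwo ^c \<tau>" using \<tau> by (simp add: ordLess_ctwo_cexp ordLess_imp_ordLeq)
  moreover have "ctwo ^c \<tau> \<le>o ?\<kappa>" using inf by (simp add: ordLess_ctwo_cexp ordLess_imp_ordLeq)
  ultimately have "\<tau> \<le>o ?\<kappa>" by (rule ordLeq_transitive)
  then have "|Field \<tau>| \<le>o ?\<kappa>" using \<tau> card_of_Field_ordIso ordIso_ordLeq_trans by blast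
  then have 1: "|Field \<tau> <+> B| \<le>o ?\<kappa>"
    using le inf by (intro card_of_Plus_ordLeq_infinite_Field) (auto simp: cinfinite_def)
  have P: "|Pow X| =o ctwo ^c r" if "|X| =o r" "Card_order r" for X :: "'x set" and r :: "'y rel"
  proof -
    have "|Pow X| =o ctwo ^c |X|"
      unfolding ctwo_def cexp_def Field_card_of by (rule card_of_Pow_Func)
    also have "ctwo ^c |X| =o ctwo ^c r" using that by (intro cexp_cong2) (auto simp: Card_order_ctwo card_of_Card_order)
    finally show ?thesis .
  qed
  have "|Pow (Pow (Field \<tau>))| =o ?\<kappa>"
    using \<tau> inf by (intro P card_of_Field_ordIso) auto
  then have "|Field \<tau> <+> B| \<le>o |Pow (Pow (Field \<tau>))|"
    using 1 ordIso_symmetric ordLeq_ordIso_trans by blast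
  then show ?thesis by (subst (asm) card_of_ordLeq[symmetric])
qed

section \<open>Precompact topologies induced by characters\<close>

definition torus :: "'i set \<Rightarrow> ('i \<Rightarrow> complex) monoid" where
  "torus I = \<lparr>carrier = I \<rightarrow>\<^sub>E sphere 0 1, monoid.mult = (\<lambda>f g. \<lambda>i\<in>I. f i * g i), one = (\<lambda>i\<in>I. 1)\<rparr>"

definition torus_topology :: "'i set \<Rightarrow> ('i \<Rightarrow> complex) topology" where
  "torus_topology I = product_topology (\<lambda>_. top_of_set (sphere 0 1)) I"

lemma torus_simps [simp]:
  "carrier (torus I) = (I \<rightarrow>\<^sub>E sphere 0 1)"
  "f \<otimes>\<^bsub>torus I\<^esub> g = (\<lambda>i\<in>I. f i * g i)" "\<one>\<^bsub>torus I\<^esub> = (\<lambda>i\<in>I. 1)"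
  by (simp_all add: torus_def)

lemma torus_inverse:
  assumes "f \<in> I \<rightarrow>\<^sub>E sphere 0 1"
  shows "(\<lambda>i\<in>I. inverse (f i)) \<in> I \<rightarrow>\<^sub>E sphere 0 1"
    "(\<lambda>i\<in>I. inverse (f i)) \<otimes>\<^bsub>torus I\<^esub> f = \<one>\<^bsub>torus I\<^esub>"
proof -
  have n: "norm (f i) = 1" if "i \<in> I" for i using assms that by (auto simp: PiE_iff)
  then show "(\<lambda>i\<in>I. inverse (f i)) \<in> I \<rightarrow>\<^sub>E sphere 0 1" by (auto simp: norm_inverse)
  have "f i \<noteq> 0" if "i \<in> I" for i using n[OF that] by auto
  then show "(\<lambda>i\<in>I. inverse (f i)) \<otimes>\<^bsub>torus I\<^esub> f = \<one>\<^bsub>torus I\<^esub>"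
    by (auto simp: fun_eq_iff)
qed

lemma group_torus: "group (torus I)"
proof (rule groupI)
  fix f assume "f \<in> carrier (torus I)"
  then show "\<exists>g\<in>carrier (torus I). g \<otimes>\<^bsub>torus I\<^esub> f = \<one>\<^bsub>torus I\<^esub>"
    using torus_inverse[of f I] unfolding torus_simps(1) by blast
next
  fix f assume f: "f \<in> carrier (torus I)"
  then show "\<one>\<^bsub>torus I\<^esub> \<otimes>\<^bsub>torus I\<^esub> f = f"
    by (intro ext) (auto simp: PiE_iff extensional_def)
next
  fix f g h assume "f \<in> carrier (torus I)" "g \<in> carrier (torus I)" "h \<in> carrier (torus I)"
  then show "f \<otimes>\<^bsub>torus I\<^esub> g \<otimes>\<^bsub>torus I\<^esub> h = f \<otimes>\<^bsub>torus I\<^esub> (g \<otimes>\<^bsub>torus I\<^esub> h)"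
    by (auto simp: fun_eq_iff)
qed (auto simp: PiE_iff norm_mult)

lemma inv_torus: "f \<in> carrier (torus I) \<Longrightarrow> inv\<^bsub>torus I\<^esub> f = (\<lambda>i\<in>I. inverse (f i))"
  using torus_inverse[of f I] by (intro group.inv_equality[OF group_torus]) auto

lemma topspace_torus [simp]: "topspace (torus_topology I) = (I \<rightarrow>\<^sub>E sphere 0 1)"
  by (simp add: torus_topology_def)

lemma continuous_map_into_torus:
  "continuous_map X (torus_topology I) f \<longleftrightarrow>
     f ` topspace X \<subseteq> extensional I \<and>
     (\<forall>i\<in>I. continuous_map X euclidean (\<lambda>x. f x i) \<and> (\<forall>x\<in>topspace X. norm (f x i) = 1))"
  unfolding torus_topology_def continuous_map_componentwise continuous_map_in_subtopology
  by (auto simp: image_subset_iff Pi_iff)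

lemma continuous_map_torus_coordinate: "i \<in> I \<Longrightarrow> continuous_map (torus_topology I) euclidean (\<lambda>f. f i)"
  using continuous_map_product_projection[of i I "\<lambda>_. top_of_set (sphere (0::complex) 1)"]
  by (simp add: torus_topology_def continuous_map_in_subtopology)

lemma topological_group_torus: "topological_group (torus I) (torus_topology I)"
  unfolding topological_group_def
proof (intro conjI group_torus)
  let ?U = "torus_topology I"
  have mult: "continuous_map (prod_topology ?U ?U) euclidean (\<lambda>p. fst p i * snd p i)" if "i \<in> I" for i
  proof -
    have "continuous_map (prod_topology ?U ?U) euclidean ((\<lambda>f. f i) \<circ> fst)"
         "continuous_map (prod_topology ?U ?U) euclidean ((\<lambda>f. f i) \<circ> snd)"
      by (intro continuous_map_compose[of _ ?U] continuous_map_fst continuous_map_snd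
            continuous_map_torus_coordinate that)+
    then have "continuous_map (prod_topology ?U ?U) (prod_topology euclidean euclidean) (\<lambda>p. (fst p i, snd p i))"
      unfolding o_def by (rule continuous_map_pairedI)
    moreover have "continuous_map (prod_topology euclidean euclidean) euclidean (\<lambda>(x, y). x * y :: complex)"
      by (simp add: case_prod_unfold continuous_intros)
    ultimately have "continuous_map (prod_topology ?U ?U) euclidean ((\<lambda>(x, y). x * y) \<circ> (\<lambda>p. (fst p i, snd p i)))"
      by (rule continuous_map_compose)
    then show ?thesis by (simp add: o_def)
  qed
  show "continuous_map (prod_topology ?U ?U) ?U (\<lambda>(f, g). f \<otimes>\<^bsub>torus I\<^esub> g)"
    unfolding continuous_map_into_torus using mult
    by (auto simp: case_prod_unfold norm_mult PiE_iff)
  have "continuous_map ?U euclidean (\<lambda>f. inverse (f i))" if "i \<in> I" for i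
  proof -
    have "continuous_map ?U (top_of_set (sphere 0 1)) (\<lambda>f. f i)"
      using that continuous_map_product_projection[of i I "\<lambda>_. top_of_set (sphere (0::complex) 1)"]
      unfolding torus_topology_def by blast
    moreover have "continuous_on (sphere 0 1) (inverse :: complex \<Rightarrow> complex)"
      by (intro continuous_intros) auto
    then have "continuous_map (top_of_set (sphere 0 1)) euclidean (inverse :: complex \<Rightarrow> complex)" by simp
    ultimately have "continuous_map ?U euclidean (inverse \<circ> (\<lambda>f. f i))" by (rule continuous_map_compose)
    then show ?thesis by (simp add: o_def)
  qed
  then have "continuous_map ?U ?U (\<lambda>f. \<lambda>i\<in>I. inverse (f i))"
    unfolding continuous_map_into_torus by (auto simp: norm_inverse PiE_iff)
  then show "continuous_map ?U ?U (\<lambda>f. inv\<^bsub>torus I\<^esub> f)"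
    by (rule continuous_map_eq) (simp add: inv_torus)
qed simp

lemma compact_Hausdorff_torus:
  "compact_space (torus_topology I)" "Hausdorff_space (torus_topology I)"
  by (auto simp: torus_topology_def compact_space_product_topology Hausdorff_space_product_topology
      compact_space_subtopology Hausdorff_space_subtopology)

text \<open>The characters are the coordinates of a homomorphism into a compact torus, which is
  injective because they separate points. The topology is pulled back along it, and since basic open
  sets of the torus restrict only finitely many coordinates, density is a statement about finitely
  many characters at a time.\<close>

theorem precompact_group_of_characters:
  fixes G :: "('a, 'b) monoid_scheme" and \<phi> :: "'i \<Rightarrow> 'a \<Rightarrow> complex"
  assumes G: "group G" and hom: "\<And>i. i \<in> I \<Longrightarrow> \<phi> i \<in> hom G circle"
    and sep: "\<And>g. g \<in> carrier G \<Longrightarrow> g \<noteq> \<one>\<^bsub>G\<^esub> \<Longrightarrow> \<exists>i\<in>I. \<phi> i g \<noteq> 1"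
    and S: "S \<subseteq> carrier G"
    and dense: "\<And>g F e. g \<in> carrier G \<Longrightarrow> finite F \<Longrightarrow> F \<subseteq> I \<Longrightarrow> e > 0 \<Longrightarrow>
      \<exists>s\<in>S. \<forall>i\<in>F. norm (\<phi> i s - \<phi> i g) < e"
  shows "\<exists>T. precompact_group G T \<and> Hausdorff_space T \<and> T closure_of S = topspace T"
proof -
  interpret group G by (rule G)
  let ?U = "torus_topology I"
  define h where "h g = (\<lambda>i\<in>I. \<phi> i g)" for g
  define H where "H = h ` carrier G"
  define T where "T = pullback_topology (carrier G) h ?U"
  have norm: "norm (\<phi> i g) = 1" if "i \<in> I" "g \<in> carrier G" for i g
    using hom_in_carrier[OF hom[OF that(1)] that(2)] by simp
  have h_hom: "h \<in> hom G (torus I)"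
  proof (rule homI)
    fix g assume "g \<in> carrier G" then show "h g \<in> carrier (torus I)" using norm by (auto simp: h_def)
  next
    fix g g' assume "g \<in> carrier G" "g' \<in> carrier G"
    then show "h (g \<otimes>\<^bsub>G\<^esub> g') = h g \<otimes>\<^bsub>torus I\<^esub> h g'"
      using hom_mult[OF hom] by (auto simp: h_def fun_eq_iff)
  qed
  interpret h: group_hom G "torus I" h
    using h_hom group_torus by (simp add: group_hom_def group_hom_axioms_def)
  have inj: "inj_on h (carrier G)"
  proof (rule h.inj_on_one_iff[THEN iffD2], intro allI impI)
    fix g assume g: "g \<in> carrier G" "h g = \<one>\<^bsub>torus I\<^esub>"
    have "\<phi> i g = 1" if "i \<in> I" for i
      using fun_cong[OF g(2), of i] that by (simp add: h_def)
    then show "g = \<one>\<^bsub>G\<^esub>" using sep g(1) by blast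
  qed
  have hU: "h ` carrier G \<subseteq> topspace ?U" using h.hom_closed by auto
  have tT: "topspace T = carrier G"
    using hU by (auto simp: T_def topspace_pullback_topology)
  have ch: "continuous_map T ?U h"
    using continuous_map_pullback[OF continuous_map_id, of "carrier G" h ?U] by (simp add: T_def)
  have K: "topological_group (torus I) ?U" by (rule topological_group_torus)
  have cm: "continuous_map (prod_topology ?U ?U) ?U (\<lambda>(x, y). x \<otimes>\<^bsub>torus I\<^esub> y)"
    and ci: "continuous_map ?U ?U (\<lambda>x. inv\<^bsub>torus I\<^esub> x)"
    using K by (simp_all only: topological_group_def)
  have T: "topological_group G T"
    unfolding topological_group_def
  proof (intro conjI G tT)
    have "continuous_map (prod_topology T T) (prod_topology ?U ?U) (\<lambda>(x, y). (h x, h y))"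
      by (simp add: continuous_map_prod_top ch)
    then have "continuous_map (prod_topology T T) ?U ((\<lambda>(x, y). x \<otimes>\<^bsub>torus I\<^esub> y) \<circ> (\<lambda>(x, y). (h x, h y)))"
      using cm by (rule continuous_map_compose)
    then have "continuous_map (prod_topology T T) ?U (h \<circ> (\<lambda>(x, y). x \<otimes>\<^bsub>G\<^esub> y))"
      by (rule continuous_map_eq) (auto simp: tT h.hom_mult[unfolded torus_simps(2)])
    then show "continuous_map (prod_topology T T) T (\<lambda>(x, y). x \<otimes>\<^bsub>G\<^esub> y)"
      unfolding T_def[of] by (intro continuous_map_pullback') (auto simp: tT[unfolded T_def])
    have "continuous_map T ?U ((\<lambda>x. inv\<^bsub>torus I\<^esub> x) \<circ> h)"
      using ch ci by (rule continuous_map_compose)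
    then have "continuous_map T ?U (h \<circ> (\<lambda>x. inv\<^bsub>G\<^esub> x))"
      by (rule continuous_map_eq) (auto simp: tT)
    then show "continuous_map T T (\<lambda>x. inv\<^bsub>G\<^esub> x)"
      unfolding T_def by (intro continuous_map_pullback') (auto simp: tT[unfolded T_def])
  qed
  have H: "subgroup H (torus I)" unfolding H_def by (rule h.img_is_subgroup)
  have homeo: "homeomorphic_map T (subtopology ?U H) h"
    unfolding homeomorphic_map_maps
  proof
    let ?k = "inv_into (carrier G) h"
    have kh: "?k (h g) = g" if "g \<in> carrier G" for g using inj that by simp
    have hk: "h (?k x) = x" "?k x \<in> carrier G" if "x \<in> H" for x
      using that by (auto simp: H_def f_inv_into_f inv_into_into)
    have "continuous_map (subtopology ?U H) ?U (h \<circ> ?k)"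
      by (rule continuous_map_eq[OF continuous_map_from_subtopology[OF continuous_map_id]]) (simp add: hk)
    then have "continuous_map (subtopology ?U H) T ?k"
      unfolding T_def by (intro continuous_map_pullback') (auto simp: hk)
    then show "homeomorphic_maps T (subtopology ?U H) h ?k"
      unfolding homeomorphic_maps_def continuous_map_in_subtopology
      using ch by (auto simp: tT kh hk H_def)
  qed
  have iso: "h \<in> iso G (torus I\<lparr>carrier := H\<rparr>)"
    using inj h.hom_mult by (auto simp: iso_def hom_def bij_betw_def H_def)
  have "precompact_group G T"
    using precompact_groupI[OF T K compact_Hausdorff_torus H] iso homeo
    by (simp add: topological_group_iso_def)
  moreover have "Hausdorff_space T"
    using homeo Hausdorff_space_subtopology[OF compact_Hausdorff_torus(2)]
      homeomorphic_Hausdorff_space homeomorphic_map_imp_homeomorphic_space by blast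
  moreover have "T closure_of S = topspace T"
  proof (intro equalityI closure_of_subset_topspace subsetI)
    fix g assume "g \<in> topspace T"
    then have g: "g \<in> carrier G" by (simp add: tT)
    show "g \<in> T closure_of S"
      unfolding in_closure_of
    proof (intro conjI allI impI)
      fix V assume "g \<in> V \<and> openin T V"
      then obtain W where W: "openin ?U W" "V = h -` W \<inter> carrier G" "h g \<in> W"
        unfolding T_def openin_pullback_topology by auto
      obtain B where B: "finite {i\<in>I. B i \<noteq> sphere 0 1}"
        "\<And>i. i \<in> I \<Longrightarrow> openin (top_of_set (sphere 0 1)) (B i)" "h g \<in> Pi\<^sub>E I B" "Pi\<^sub>E I B \<subseteq> W"
        using W(1,3) unfolding torus_topology_def openin_product_topology_alt by fastforce
      \<comment> \<open>The coordinates that the basic box really restricts.\<close>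
      define F where "F = {i\<in>I. B i \<noteq> sphere 0 1}"
      have "\<exists>e>0. \<forall>z. norm z = 1 \<longrightarrow> norm (z - \<phi> i g) < e \<longrightarrow> z \<in> B i" if i: "i \<in> I" for i
      proof -
        have "\<phi> i g \<in> B i" using PiE_mem[OF B(3) i] i by (simp add: h_def)
        then obtain e where "e > 0" "\<forall>z\<in>sphere 0 1. dist z (\<phi> i g) < e \<longrightarrow> z \<in> B i"
          using B(2)[OF i] unfolding openin_euclidean_subtopology_iff by blast
        then show ?thesis by (intro exI[of _ e]) (simp add: dist_norm)
      qed
      then have "\<forall>i\<in>I. \<exists>e>0. \<forall>z. norm z = 1 \<longrightarrow> norm (z - \<phi> i g) < e \<longrightarrow> z \<in> B i" by blast
      from bchoice[OF this] obtain e where e: "\<And>i. i \<in> I \<Longrightarrow> e i > 0"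
        "\<And>i z. i \<in> I \<Longrightarrow> norm z = 1 \<Longrightarrow> norm (z - \<phi> i g) < e i \<Longrightarrow> z \<in> B i" by blast
      \<comment> \<open>The \<open>1\<close> provides a minimum also when \<open>F\<close> is
        empty.\<close>
      define \<epsilon> where "\<epsilon> = Min (insert 1 (e ` F))"
      have F: "finite F" "F \<subseteq> I" using B(1) by (auto simp: F_def)
      have \<epsilon>: "\<epsilon> > 0" "\<And>i. i \<in> F \<Longrightarrow> \<epsilon> \<le> e i" using F e(1) by (auto simp: \<epsilon>_def)
      obtain s where s: "s \<in> S" "\<And>i. i \<in> F \<Longrightarrow> norm (\<phi> i s - \<phi> i g) < \<epsilon>"
        using dense[OF g F \<epsilon>(1)] by blast
      have sG: "s \<in> carrier G" using s S by blast
      have "\<phi> i s \<in> B i" if i: "i \<in> I" for i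
      proof (cases "i \<in> F")
        case True
        then show ?thesis using e(2)[OF i norm[OF i sG]] s(2)[OF True] \<epsilon>(2)[OF True] by simp
      next
        case False
        then show ?thesis using norm[OF i sG] i by (simp add: F_def)
      qed
      then have "h s \<in> W" using B(4) by (auto simp: h_def)
      then show "\<exists>y. y \<in> S \<and> y \<in> V" using s(1) sG W(2) by blast
    qed (simp add: tT g)
  qed
  ultimately show ?thesis by blast
qed

section \<open>Wide sets are potentially dense\<close>

text \<open>As \<open>\<tau>\<close> is a cardinal order, each point has fewer than
  \<open>\<tau>\<close> predecessors, so wideness applies to the set of elements chosen
  before.\<close>

lemma (in group) exists_wide_sequence:
  fixes m :: "'t \<Rightarrow> nat"
  assumes \<tau>: "Card_order \<tau>" and S: "wide \<tau> G S" and m: "\<And>a. m a > 0"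
  obtains f where "\<And>a. a \<in> Field \<tau> \<Longrightarrow> f a \<in> S"
    "\<And>a. a \<in> Field \<tau> \<Longrightarrow> f a [^] m a \<notin> generate G (f ` underS \<tau> a)"
proof -
  define P where "P f a x \<longleftrightarrow> (a \<in> Field \<tau> \<longrightarrow> x \<in> S \<and> x [^] m a \<notin> generate G (f ` underS \<tau> a))" for f a x
  have "Well_order \<tau>" using \<tau> by (rule card_order_on_well_order_on)
  then have wf: "wf (\<tau> - Id)" by (simp add: well_order_on_def)
  have "\<exists>f. \<forall>a. P f a (f a)"
  proof (rule dependent_wf_choice[OF wf])
    fix f g :: "'t \<Rightarrow> 'a" and a x
    assume "\<And>b. (b, a) \<in> \<tau> - Id \<Longrightarrow> f b = g b"
    then have "f ` underS \<tau> a = g ` underS \<tau> a" by (intro image_cong) (auto simp: underS_def)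
    then show "P f a x = P g a x" by (simp add: P_def)
  next
    fix a and f :: "'t \<Rightarrow> 'a"
    assume IH: "\<And>b. (b, a) \<in> \<tau> - Id \<Longrightarrow> P f b (f b)"
    show "\<exists>x. P f a x"
    proof (cases "a \<in> Field \<tau>")
      case True
      have "f ` underS \<tau> a \<subseteq> S" using IH by (auto simp: P_def underS_def Field_def)
      moreover have "|f ` underS \<tau> a| <o \<tau>"
        using card_of_image card_of_underS[OF \<tau> True] by (rule ordLeq_ordLess_trans)
      ultimately have "(\<lambda>x. x [^] m a) ` S - generate G (f ` underS \<tau> a) \<noteq> {}"
        by (intro S[unfolded wide_def, THEN conjunct2, rule_format] conjI m)
      then obtain x where "x \<in> S" "x [^] m a \<notin> generate G (f ` underS \<tau> a)" by auto
      then show ?thesis unfolding P_def by (intro exI[of _ x]) simp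
    qed (simp add: P_def)
  qed
  then obtain f where f: "\<forall>a. P f a (f a)" by (rule exE)
  show thesis by (rule that[of f]) (use f in \<open>simp_all add: P_def\<close>)
qed

text \<open>All of \<open>Field \<tau>\<close> is placed before \<open>B\<close>. Hence the
  generators from the wide set have only each other as predecessors, and their orders modulo the
  subgroup below them are those arranged by the choice of the sequence.\<close>

lemma exists_sum_well_order:
  fixes \<tau> :: "'t rel" and B :: "'a set"
  assumes "Well_order \<tau>"
  obtains R :: "('t + 'a) rel" where "wf R" "trans R" "total_on (Field \<tau> <+> B) R"
    "\<And>a. {v \<in> Field \<tau> <+> B. (v, Inl a) \<in> R} = Inl ` underS \<tau> a"
proof -
  obtain Q :: "'a rel" where Q: "well_order_on UNIV Q" using well_order_on by blast
  \<comment> \<open>The first component separates the summands; within a summand the component set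
    to \<open>undefined\<close> is constant, so the other one decides.\<close>
  define k where "k v = (case v of Inl a \<Rightarrow> (0 :: nat, a, undefined) | Inr g \<Rightarrow> (1, undefined, g))" for v :: "'t + 'a"
  define R where "R = inv_image (less_than <*lex*> (\<tau> - Id) <*lex*> (Q - Id)) k"
  have trans_Id: "trans (r - Id)" if "well_order_on A r" for r :: "'x rel" and A
    using that unfolding well_order_on_def linear_order_on_def partial_order_on_def preorder_on_def
    by (intro trans_diff_Id) auto
  show thesis
  proof
    show "wf R" unfolding R_def
      using assms Q unfolding well_order_on_def by (intro wf_inv_image wf_lex_prod wf_less_than) auto
    show "trans R" unfolding R_def
      using trans_Id[OF assms] trans_Id[OF Q] by (intro trans_inv_image trans_lex_prod) auto
    have "total_on (Field \<tau>) \<tau>" "total_on UNIV Q"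
      using assms Q by (auto simp: well_order_on_def linear_order_on_def)
    then show "total_on (Field \<tau> <+> B) R"
      unfolding total_on_def R_def k_def by (auto simp: Plus_def; blast)
    show "{v \<in> Field \<tau> <+> B. (v, Inl a) \<in> R} = Inl ` underS \<tau> a" for a
      by (auto simp: R_def k_def underS_def Field_def)
  qed
qed

theorem theorem3p3:
  fixes \<tau> :: "'t rel" and G :: "('a, 'b) monoid_scheme" and S :: "'a set"
  assumes "Cinfinite \<tau>"
    and "comm_group G"
    and "wide \<tau> G S"
    and "|carrier G| \<le>o ctwo ^c (ctwo ^c \<tau>)"
  shows "\<exists>T. precompact_group G T \<and> Hausdorff_space T \<and> T closure_of S = topspace T"
proof -
  interpret comm_group G by (rule assms(2))
  let ?W = "Field \<tau>"
  let ?\<Lambda> = "?W <+> carrier G"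
  have W: "infinite ?W" and \<tau>: "Card_order \<tau>" using assms(1) by (auto simp: cinfinite_def)
  then have wo: "Well_order \<tau>" by (simp add: card_order_on_well_order_on)
  have SG: "S \<subseteq> carrier G" using assms(3) by (simp add: wide_def)
  obtain e :: "'t \<Rightarrow> nat \<times> ('t literals \<times> int) list"
    where e: "UNIV \<times> lists (literals_over ?W \<times> UNIV) \<subseteq> e ` ?W"
    using exists_step_data_enumeration[OF W] by blast
  \<comment> \<open>At \<open>Inl a\<close> the enumeration supplies precision and target. At an
    element of the group the value \<open>1\<close> demands nothing of the order, because a positive
    order is at least \<open>1\<close>.\<close>
  define m where "m = case_sum (\<lambda>a. Suc (fst (e a))) (\<lambda>_::'a. 1)"
  define t where "t = case_sum (\<lambda>a. step_value (m (Inl a)) (snd (e a))) (\<lambda>(_::'a) _. 1)"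
  \<comment> \<open>Every positive number up to \<open>m (Inl a)\<close> divides its factorial.
    Avoiding this single power therefore makes the order modulo the predecessors infinite or larger
    than \<open>m (Inl a)\<close>.\<close>
  obtain f where f: "\<And>a. a \<in> ?W \<Longrightarrow> f a \<in> S"
    "\<And>a. a \<in> ?W \<Longrightarrow> f a [^]\<^bsub>G\<^esub> (fact (m (Inl a)) :: nat) \<notin> generate G (f ` underS \<tau> a)"
    using exists_wide_sequence[OF \<tau> assms(3), of "\<lambda>a. fact (m (Inl a))"] by auto
  obtain R :: "('t + 'a) rel" where R: "wf R" "trans R" "total_on ?\<Lambda> R"
    "\<And>a. {v \<in> ?\<Lambda>. (v, Inl a) \<in> R} = Inl ` underS \<tau> a"
    using exists_sum_well_order[OF wo, of "carrier G"] by blast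
  \<comment> \<open>All elements of the group follow as further generators, so that the characters
    become defined everywhere. An element that is already generated has order \<open>1\<close>
    modulo its predecessors.\<close>
  define s where "s = case_sum f (\<lambda>g. g)"
  have s: "s ` ?\<Lambda> = carrier G" using f(1) SG by (auto simp: s_def Plus_def image_Un image_image)
  have s_below: "s ` {v \<in> ?\<Lambda>. (v, w) \<in> R} \<subseteq> carrier G" for w using s by auto
  have "\<exists>d::nat. \<forall>k::int. s w [^]\<^bsub>G\<^esub> k \<in> generate G (s ` {v\<in>?\<Lambda>. (v, w) \<in> R}) \<longleftrightarrow> int d dvd k"
    if "w \<in> ?\<Lambda>" for w
    using s that by (intro subgroup_int_pow_mem_iff generate_is_subgroup s_below) auto
  then have "\<forall>w\<in>?\<Lambda>. \<exists>d::nat. \<forall>k::int. s w [^]\<^bsub>G\<^esub> k \<in> generate G (s ` {v\<in>?\<Lambda>. (v, w) \<in> R}) \<longleftrightarrow> int d dvd k"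
    by blast
  from bchoice[OF this] obtain d :: "'t + 'a \<Rightarrow> nat" where d: "\<And>w k. w \<in> ?\<Lambda> \<Longrightarrow>
      s w [^]\<^bsub>G\<^esub> (k::int) \<in> generate G (s ` {v\<in>?\<Lambda>. (v, w) \<in> R}) \<longleftrightarrow> int (d w) dvd k" by blast
  interpret transfinite_generators G ?\<Lambda> R s d
  proof
    show "generate G (s ` ?\<Lambda>) = carrier G"
      unfolding s by (intro equalityI generate_incl order.refl subsetI) (rule generate.incl)
    show "s ` ?\<Lambda> \<subseteq> carrier G" by (simp add: s)
  qed (fact R d)+
  obtain A where A: "inj_on A ?\<Lambda>" "A ` ?\<Lambda> \<subseteq> Pow (Pow ?W)"
    using exists_double_power_code[OF assms(1,4)] by blast
  define I where "I = {i. \<forall>n::nat. i n \<subseteq> ?W}"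
  have m_le: "d w = 0 \<or> m w \<le> d w" if w: "w \<in> ?\<Lambda>" for w
  proof (cases w)
    case (Inl a)
    then have a: "a \<in> ?W" using w by auto
    have "s ` {v \<in> ?\<Lambda>. (v, w) \<in> R} = f ` underS \<tau> a"
      unfolding Inl R(4) by (simp add: s_def image_image)
    then have "\<not> int (d w) dvd int (fact (m w))"
      using f(2)[OF a] d[OF w, of "int (fact (m w))"] unfolding int_pow_int by (simp add: Inl s_def)
    then show ?thesis using dvd_fact[of "d w" "m w"] unfolding int_dvd_int_iff by linarith
  next
    case (Inr g)
    then show ?thesis by (auto simp: m_def)
  qed
  have t_cong: "\<exists>N. \<forall>i i'. (\<forall>n<N. i n = i' n) \<longrightarrow> t w i = t w i'" for w
    by (cases w) (auto simp: t_def step_value_cong)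
  have indep: "\<exists>i\<in>I. \<exists>i'\<in>I. (\<forall>n<N. i n = i' n) \<and>
      (\<forall>v\<in>E. eventually_separates (A v) i = eventually_separates (A v) i') \<and>
      eventually_separates (A w) i \<and> \<not> eventually_separates (A w) i'"
    if w: "w \<in> ?\<Lambda>" and E: "finite E" "E \<subseteq> ?\<Lambda> - {w}" for w E N
  proof -
    have "?W \<noteq> {}" using W by auto
    moreover have "A w \<subseteq> Pow ?W" using A(2) w by blast
    moreover have "finite (A ` E)" using E by simp
    moreover have "B \<subseteq> Pow ?W" if "B \<in> A ` E" for B using A(2) E(2) that by blast
    moreover have "A w \<notin> A ` E" using inj_on_image_mem_iff[OF A(1) w, of E] E(2) by blast
    ultimately obtain i i' where "\<And>n. i n \<subseteq> ?W" "\<And>n. i' n \<subseteq> ?W" "\<And>n. n < N \<Longrightarrow> i n = i' n"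
      "eventually_separates (A w) i" "\<And>B. B \<in> insert (A w) (A ` E) \<Longrightarrow> \<not> eventually_separates B i'"
      "\<And>B. B \<in> A ` E \<Longrightarrow> \<not> eventually_separates B i"
      by (rule eventually_separates_independent[where N=N]) (assumption, blast)
    then show ?thesis unfolding I_def by (intro bexI[of _ i] bexI[of _ i']) auto
  qed
  have norm_t: "norm (t w i) = 1" for w i by (cases w) (simp_all add: t_def norm_step_value)
  have m_pos: "m w > 0" if "w \<in> ?\<Lambda>" for w by (cases w) (simp_all add: m_def)
  obtain \<phi> where \<phi>: "\<And>i. \<phi> i \<in> hom G circle"
    "\<And>w i. w \<in> ?\<Lambda> \<Longrightarrow> norm (\<phi> i (s w) - t w i) \<le> 3 * pi / real (m w)"
    "\<And>g. g \<in> carrier G \<Longrightarrow> g \<noteq> \<one>\<^bsub>G\<^esub> \<Longrightarrow> \<exists>i\<in>I. \<phi> i g \<noteq> 1"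
    by (rule exists_separating_characters[where t=t and m=m and I=I
        and q="\<lambda>v. eventually_separates (A v)", OF norm_t t_cong m_pos m_le indep]) (assumption | blast)+
  show ?thesis
  proof (rule precompact_group_of_characters[of G I \<phi> S])
    fix g F and \<epsilon> :: real
    assume g: "g \<in> carrier G" and F: "finite F" "F \<subseteq> I" and \<epsilon>: "\<epsilon> > 0"
    have norm: "norm (\<phi> i g) = 1" for i using hom_in_carrier[OF \<phi>(1) g] by simp
    \<comment> \<open>The share \<open>3 * pi\<close> is the error at the generator, and
      \<open>1\<close> is the error of rounding \<open>\<phi> i g\<close> to a point
      \<open>cis (p / Suc n)\<close>.\<close>
    obtain n :: nat where n: "(3 * pi + 1) / \<epsilon> < real n" using reals_Archimedean2 by blast
    have "\<exists>p::int. norm (cis (of_int p / real (Suc n)) - \<phi> i g) \<le> 1 / real (Suc n)" for i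
      using norm by (intro exists_near_cis) auto
    then have "\<forall>i. \<exists>p::int. norm (cis (of_int p / real (Suc n)) - \<phi> i g) \<le> 1 / real (Suc n)" by blast
    from choice[OF this] obtain p :: "(nat \<Rightarrow> 't set) \<Rightarrow> int" where
      p: "\<And>i. norm (cis (of_int (p i) / real (Suc n)) - \<phi> i g) \<le> 1 / real (Suc n)" by blast
    have FW: "\<forall>i\<in>F. \<forall>n. i n \<subseteq> ?W" using F(2) by (auto simp: I_def)
    obtain L where L: "L \<in> lists (literals_over ?W \<times> UNIV)"
      "\<And>i. i \<in> F \<Longrightarrow> step_value (Suc n) L i = cis (of_int (p i) / real (Suc n))"
      using exists_step_value[OF F(1) FW, of "Suc n" p] by blast
    \<comment> \<open>The enumeration contains the precision and step function just found, so the
      element of \<open>S\<close> chosen at the index \<open>a\<close> has nearly the prescribed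
      values.\<close>
    have "(n, L) \<in> e ` ?W" using L(1) e by blast
    then obtain a where a: "a \<in> ?W" "e a = (n, L)" by auto
    have m: "m (Inl a) = Suc n" using a(2) by (simp add: m_def)
    have "norm (\<phi> i (f a) - \<phi> i g) < \<epsilon>" if i: "i \<in> F" for i
    proof -
      have "t (Inl a) i = cis (of_int (p i) / real (Suc n))"
        using L(2)[OF i] a(2) m by (simp add: t_def)
      then have "norm (\<phi> i (f a) - cis (of_int (p i) / real (Suc n))) \<le> 3 * pi / real (Suc n)"
        using \<phi>(2)[OF InlI[OF a(1)], of i] m by (simp add: s_def)
      then have "norm (\<phi> i (f a) - \<phi> i g) \<le> 3 * pi / real (Suc n) + 1 / real (Suc n)"
        using p[of i] by (rule norm_diff_triangle_le)
      also have "\<dots> = (3 * pi + 1) / real (Suc n)" by (simp add: add_divide_distrib)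
      also have "\<dots> < \<epsilon>"
      proof -
        have "3 * pi + 1 < real n * \<epsilon>" using n \<epsilon> by (simp add: field_simps)
        also have "\<dots> \<le> real (Suc n) * \<epsilon>" using \<epsilon> by (intro mult_right_mono) auto
        finally show ?thesis by (simp add: field_simps)
      qed
      finally show ?thesis .
    qed
    then show "\<exists>x\<in>S. \<forall>i\<in>F. norm (\<phi> i x - \<phi> i g) < \<epsilon>" using f(1)[OF a(1)] by blast
  qed (use \<phi> SG is_group in auto)
qed

end
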